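(* Let $\lambda=m$. The Markov process $\{\mathcal T_t\}_{t\ge0}$, $\mathcal T_t=\theta^{X_t}\mathcal T$ (the environment viewed from the $\lambda$-biased random walk), with initial measure $\mathrm{IGWR}$, is stationary and reversible.
   Context: Let $\{p_k\}_{k\ge 0}$ be a probability distribution with $p_0=0$, mean $m=\sum_k kp_k>1$, and $\sum_k\beta^kp_k<\infty$ for some $\beta>1$. Trees with a marked ray: consider infinite trees $\mathcal T$ with a distinguished vertex $o$ (the root) and a marked semi-infinite path $\mathrm{Ray}$ starting at $o$; $d$ is the graph distance. A vertex $w$ is an offspring of $v$ if $d(v,w)=1$ and either $d(w,\mathrm{Ray})>d(v,\mathrm{Ray})$, or $v,w\in\mathrm{Ray}$ and $d(v,o)>d(w,o)$; thus every vertex has a unique parent. $d_v$ is the number of offspring of $v$. Measure $\mathrm{IGWR}$ on such trees: all offspring numbers are independent; each $v\in\mathrm{Ray}$, $v\neq o$, has $P(d_v=k)=kp_k/m$, one of its offspring being identified with the next vertex of $\mathrm{Ray}$ towards $o$; the root has $P(d_o=k)=(m+k)p_k/(2m)$; all other vertices have the offspring law $\{p_k\}$. Walk: given $\mathcal T$, $\{X_n\}$ is the Markov chain with $X_0=o$ that moves from $v$ to its parent with probability $\lambda/(\lambda+d_v)$ and to each offspring with probability $1/(\lambda+d_v)$. Shifts: for a neighbor $v$ of $o$, $\theta^v\mathcal T$ is the tree obtained by moving the root to $v$ and adding or erasing one edge from $\mathrm{Ray}$ in the only way that leaves an infinite ray emanating from the new root (the parent/offspring relations are unchanged). For an arbitrary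 vertex $w$, $\theta^w\mathcal T$ is obtained by composing these shifts along the geodesic from $o$ to $w$. Rooted trees with marked ray are regarded up to isomorphisms preserving root and ray. Then $\mathcal T_t=\theta^{X_t}\mathcal T$ is a Markov process: from $\mathcal T$, it makes one step of the $\lambda$-biased walk from $o$ and then moves the root to the new position of the walk, adjusting $\mathrm{Ray}$ accordingly. *)

theory Defs
  imports "HOL-Probability.Probability"
begin

section \<open>Infinite trees with a marked ray\<close>

text \<open>
  The root is the initial vertex of the ray. The notions below are only meaningful for structures
  satisfying \<open>rayed_tree\<close>.
\<close>

record 'v rtree =
  verts :: "'v set"
  adj :: "'v \<Rightarrow> 'v \<Rightarrow> bool"
  ray :: "nat \<Rightarrow> 'v"

abbreviation rt_root :: "'v rtree \<Rightarrow> 'v" where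
  "rt_root T \<equiv> ray T 0"

definition walk_between :: "'v rtree \<Rightarrow> 'v \<Rightarrow> 'v \<Rightarrow> 'v list \<Rightarrow> bool" where
  "walk_between T u v xs \<longleftrightarrow>
     xs \<noteq> [] \<and> set xs \<subseteq> verts T \<and> successively (adj T) xs \<and> hd xs = u \<and> last xs = v"

definition rayed_tree :: "'v rtree \<Rightarrow> bool" where
  "rayed_tree T \<longleftrightarrow>
     infinite (verts T) \<and>
     (\<forall>u v. adj T u v \<longrightarrow> u \<in> verts T \<and> v \<in> verts T \<and> u \<noteq> v \<and> adj T v u) \<and>
     (\<forall>v\<in>verts T. finite {w. adj T v w}) \<and>
     (\<forall>u\<in>verts T. \<forall>v\<in>verts T. \<exists>!xs. walk_between T u v xs \<and> distinct xs) \<and>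
     range (ray T) \<subseteq> verts T \<and> inj (ray T) \<and> (\<forall>n. adj T (ray T n) (ray T (Suc n)))"

definition gdist :: "'v rtree \<Rightarrow> 'v \<Rightarrow> 'v \<Rightarrow> nat" where
  "gdist T u v = (LEAST n. \<exists>xs. walk_between T u v xs \<and> length xs = Suc n)"

definition ray_dist :: "'v rtree \<Rightarrow> 'v \<Rightarrow> nat" where
  "ray_dist T v = (LEAST n. \<exists>k. gdist T v (ray T k) = n)"

definition geodesic :: "'v rtree \<Rightarrow> 'v \<Rightarrow> 'v \<Rightarrow> 'v list" where
  "geodesic T u v = (THE xs. walk_between T u v xs \<and> length xs = Suc (gdist T u v))"

definition offspring :: "'v rtree \<Rightarrow> 'v \<Rightarrow> 'v set" where
  "offspring T v = {w. v \<in> verts T \<and> w \<in> verts T \<and> gdist T v w = 1 \<and>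
     (ray_dist T w > ray_dist T v \<or>
      v \<in> range (ray T) \<and> w \<in> range (ray T) \<and> gdist T v (rt_root T) > gdist T w (rt_root T))}"

definition parent :: "'v rtree \<Rightarrow> 'v \<Rightarrow> 'v" where
  "parent T w = (THE v. w \<in> offspring T v)"

definition outdeg :: "'v rtree \<Rightarrow> 'v \<Rightarrow> nat" where
  "outdeg T v = card (offspring T v)"

section \<open>Shifts\<close>

text \<open>Shift to a neighbour of the root: if it lies on the ray, the first edge of the ray is
  erased, otherwise the edge joining it to the root is put in front of the ray.\<close>

definition shift1 :: "'v \<Rightarrow> 'v rtree \<Rightarrow> 'v rtree" where
  "shift1 v T = T\<lparr>ray := if v = ray T 1 then (\<lambda>n. ray T (Suc n)) else case_nat v (ray T)\<rparr>"

text \<open>The value at a \<open>w\<close> that is not a vertex is immaterial: the walk never visits such a \<open>w\<close>.\<close>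

definition shift :: "'v \<Rightarrow> 'v rtree \<Rightarrow> 'v rtree" where
  "shift w T = (if w \<in> verts T then fold shift1 (tl (geodesic T (rt_root T) w)) T else T)"

section \<open>The space of isomorphism classes\<close>

definition rt_iso :: "'v rtree \<Rightarrow> 'w rtree \<Rightarrow> bool" where
  "rt_iso T S \<longleftrightarrow> (\<exists>f. bij_betw f (verts T) (verts S) \<and>
     (\<forall>u\<in>verts T. \<forall>v\<in>verts T. adj T u v \<longleftrightarrow> adj S (f u) (f v)) \<and>
     (\<forall>n. f (ray T n) = ray S n))"

text \<open>
  Locally finite infinite trees have countably many vertices, so every isomorphism class is
  represented on any fixed countably infinite set of labels. The label \<open>(n, [i\<^sub>1, \<dots>, i\<^sub>k])\<close> is
  intended for the vertex reached from the \<open>n\<close>-th vertex of the ray by descending, away from the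
  ray, to child \<open>i\<^sub>1\<close>, then to its child \<open>i\<^sub>2\<close>, and so on.
\<close>

type_synonym label = "nat \<times> nat list"

definition iso_class :: "label rtree \<Rightarrow> label rtree set" where
  "iso_class T = {S. rayed_tree S \<and> rt_iso T S}"

definition rball :: "'v rtree \<Rightarrow> nat \<Rightarrow> 'v set" where
  "rball T r = {v \<in> verts T. gdist T (rt_root T) v \<le> r}"

definition rball_iso :: "nat \<Rightarrow> 'v rtree \<Rightarrow> 'w rtree \<Rightarrow> bool" where
  "rball_iso r T S \<longleftrightarrow> (\<exists>f. bij_betw f (rball T r) (rball S r) \<and>
     (\<forall>u\<in>rball T r. \<forall>v\<in>rball T r. adj T u v \<longleftrightarrow> adj S (f u) (f v)) \<and>
     (\<forall>n\<le>r. f (ray T n) = ray S n))"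

text \<open>The Borel sets of the local topology: a basic event prescribes the isomorphism type of a
  ball around the root, together with the part of the ray inside it.\<close>

definition tree_space :: "label rtree set measure" where
  "tree_space = sigma (iso_class ` {T. rayed_tree T})
     {iso_class ` {T. rayed_tree T \<and> rball_iso r T S} | r (S :: label rtree). rayed_tree S}"

section \<open>The measure IGWR\<close>

text \<open>
  The tree determined by a family \<open>\<omega>\<close> of offspring numbers. A ray vertex \<open>(Suc n, [])\<close> has
  \<open>(n, [])\<close> as one of its \<open>\<omega> (Suc n, [])\<close> offspring, hence \<open>\<omega> (Suc n, []) - 1\<close> children off the
  ray (under IGWR this number \<open>\<omega> (Suc n, [])\<close> is almost surely positive).
\<close>

fun off_ray_children :: "(label \<Rightarrow> nat) \<Rightarrow> label \<Rightarrow> nat" where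
  "off_ray_children \<omega> (n, is) = (if is = [] \<and> n \<noteq> 0 then \<omega> (n, is) - 1 else \<omega> (n, is))"

definition tree_labels :: "(label \<Rightarrow> nat) \<Rightarrow> label set" where
  "tree_labels \<omega> = {(n, is). \<forall>j<length is. is ! j < off_ray_children \<omega> (n, take j is)}"

definition child_label :: "label \<Rightarrow> label \<Rightarrow> bool" where
  "child_label u v \<longleftrightarrow> (\<exists>n is i. u = (n, is) \<and> v = (n, is @ [i])) \<or>
     (\<exists>n. u = (Suc n, []) \<and> v = (n, []))"

definition tree_of :: "(label \<Rightarrow> nat) \<Rightarrow> label rtree" where
  "tree_of \<omega> = \<lparr>verts = tree_labels \<omega>,
     adj = (\<lambda>u v. u \<in> tree_labels \<omega> \<and> v \<in> tree_labels \<omega> \<and> (child_label u v \<or> child_label v u)),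
     ray = (\<lambda>n. (n, []))\<rparr>"

definition mean :: "nat pmf \<Rightarrow> real" where
  "mean p = measure_pmf.expectation p real"

fun offspring_law :: "nat pmf \<Rightarrow> label \<Rightarrow> nat pmf" where
  "offspring_law p (n, is) =
     (if is \<noteq> [] then p
      else if n \<noteq> 0 then embed_pmf (\<lambda>k. real k * pmf p k / mean p)
      else embed_pmf (\<lambda>k. (mean p + real k) * pmf p k / (2 * mean p)))"

definition offspring_numbers :: "nat pmf \<Rightarrow> (label \<Rightarrow> nat) measure" where
  "offspring_numbers p = (\<Pi>\<^sub>M v\<in>UNIV. measure_pmf (offspring_law p v))"

definition IGWR :: "nat pmf \<Rightarrow> label rtree set measure" where
  "IGWR p = distr (offspring_numbers p) tree_space (\<lambda>\<omega>. iso_class (tree_of \<omega>))"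

section \<open>The biased walk and the environment seen from it\<close>

definition step :: "real \<Rightarrow> 'v rtree \<Rightarrow> 'v \<Rightarrow> 'v pmf" where
  "step lam T v = embed_pmf (\<lambda>w.
     if w = parent T v then lam / (lam + real (outdeg T v))
     else if w \<in> offspring T v then 1 / (lam + real (outdeg T v)) else 0)"

text \<open>
  The random tree and the walk on it are realised together as a sequence of pairs \<open>(\<omega>, v)\<close>: the
  offspring numbers \<open>\<omega>\<close> are drawn at time 0 and kept forever, while \<open>v\<close> starts at the root and
  moves as the biased walk on \<open>tree_of \<omega>\<close>. The law of the whole sequence is the one provided by
  the Ionescu-Tulcea theorem.
\<close>

definition state_space :: "((label \<Rightarrow> nat) \<times> label) measure" where
  "state_space = (\<Pi>\<^sub>M v\<in>UNIV. count_space UNIV) \<Otimes>\<^sub>M count_space UNIV"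

primrec walk_kernel ::
  "nat pmf \<Rightarrow> real \<Rightarrow> nat \<Rightarrow> (nat \<Rightarrow> (label \<Rightarrow> nat) \<times> label) \<Rightarrow> ((label \<Rightarrow> nat) \<times> label) measure" where
  "walk_kernel p lam 0 h =
     distr (offspring_numbers p) state_space (\<lambda>\<omega>. (\<omega>, rt_root (tree_of \<omega>)))"
| "walk_kernel p lam (Suc t) h = (case h t of (\<omega>, v) \<Rightarrow>
     distr (measure_pmf (step lam (tree_of \<omega>) v)) state_space (\<lambda>w. (\<omega>, w)))"

definition walk_measure :: "nat pmf \<Rightarrow> real \<Rightarrow> (nat \<Rightarrow> (label \<Rightarrow> nat) \<times> label) measure" where
  "walk_measure p lam = projective_family.lim UNIV
     (Ionescu_Tulcea.CI (walk_kernel p lam) (\<lambda>_. state_space)) (\<lambda>_. state_space)"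

definition environment :: "nat \<Rightarrow> (nat \<Rightarrow> (label \<Rightarrow> nat) \<times> label) \<Rightarrow> label rtree set" where
  "environment t h = (case h t of (\<omega>, v) \<Rightarrow> iso_class (shift v (tree_of \<omega>)))"

section \<open>Stationary and reversible processes\<close>

definition stochastic_process :: "'a measure \<Rightarrow> 'b measure \<Rightarrow> (nat \<Rightarrow> 'a \<Rightarrow> 'b) \<Rightarrow> bool" where
  "stochastic_process M N Y \<longleftrightarrow> prob_space M \<and> (\<forall>t. Y t \<in> M \<rightarrow>\<^sub>M N)"

definition stationary :: "'a measure \<Rightarrow> 'b measure \<Rightarrow> (nat \<Rightarrow> 'a \<Rightarrow> 'b) \<Rightarrow> bool" where
  "stationary M N Y \<longleftrightarrow> stochastic_process M N Y \<and>
     (\<forall>s. distr M (\<Pi>\<^sub>M t\<in>UNIV. N) (\<lambda>x t. Y (s + t) x) = distr M (\<Pi>\<^sub>M t\<in>UNIV. N) (\<lambda>x t. Y t x))"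

definition reversible :: "'a measure \<Rightarrow> 'b measure \<Rightarrow> (nat \<Rightarrow> 'a \<Rightarrow> 'b) \<Rightarrow> bool" where
  "reversible M N Y \<longleftrightarrow> stochastic_process M N Y \<and>
     (\<forall>n. distr M (\<Pi>\<^sub>M t\<in>{..n}. N) (\<lambda>x. \<lambda>t\<in>{..n}. Y (n - t) x) =
          distr M (\<Pi>\<^sub>M t\<in>{..n}. N) (\<lambda>x. \<lambda>t\<in>{..n}. Y t x))"

end

theory Submission
  imports Defs
begin

text \<open>
  Every shift of a labelled tree keeps its parent map, and its ray is the line of ancestors of the
  new root. Let \<open>K\<close> be the transition operator of the walk, acting on functions of the tree seen
  from the walker. The root law of IGWR is \<open>p\<close> with density \<open>(m + k) / (2 m)\<close>, which cancels the
  denominator \<open>m + k\<close> of the first step: with respect to the law \<open>Q\<close> having root law \<open>p\<close>, the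
  integral of \<open>F \<cdot> K G\<close> is one half of \<open>A F G + B F G\<close>, where \<open>A F G\<close> is the expectation of
  \<open>F(T) G(T')\<close> for the shift \<open>T'\<close> of \<open>T\<close> to the parent of the root, and \<open>B F G\<close> is \<open>1 / m\<close>
  times the expected sum of \<open>F(T) G(T\<^sub>i)\<close> over the shifts \<open>T\<^sub>i\<close> of \<open>T\<close> to the children of the root.
  Relabelling the tree from the child \<open>i\<close> turns the old root into a ray vertex with a size-biased
  number of offspring and shows that \<open>B F G = A G F\<close>. So \<open>K\<close> is self-adjoint for IGWR, which gives
  reversibility, and stationarity follows by reversing the paths of length \<open>n + 1\<close> and \<open>n\<close>.
\<close>

section \<open>Trees given by a parent map\<close>

text \<open>The relabelling explains the choice of the bias. With bias \<lambda> and a root density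
  proportional to \<lambda> + k, the move to the parent would carry the weight \<lambda>, while the
  sum over the moves to the children yields the factor \<open>m\<close>, the constant that
  normalises the size-biased law. The two terms are exchanged by swapping \<open>F\<close> and
  \<open>G\<close> with equal weights when \<lambda> = m.

  The obstacle is that the claim concerns isomorphism classes while the walk lives on labels.
  Instead of a Markov kernel on classes, the proof uses functions of the pair
  \<open>(\<omega>, v)\<close> that do not change under isomorphism (\<open>view_invariant\<close>).
  The walk operator preserves this property, so the argument stays on labelled trees, where the
  offspring numbers are independent coordinates; \<open>iso_class\<close> enters only through
  measurability and through indicators of events. Sums and integrals are exchanged in
  \<open>ennreal\<close>, where no integrability has to be checked.\<close>

lemma walk_between_Cons:
  "walk_between T u v (x # xs) \<longleftrightarrow> x = u \<and> u \<in> verts T \<and>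
     (if xs = [] then v = u else adj T u (hd xs) \<and> walk_between T (hd xs) v xs)"
  by (cases xs) (auto simp: walk_between_def)

lemma walk_between_adj:
  assumes "adj T u w" "u \<in> verts T" "walk_between T w v xs"
  shows "walk_between T u v (u # xs)"
  using assms by (auto simp: walk_between_def neq_Nil_conv)

lemma walk_between_suffix:
  assumes "walk_between T u v (as @ y # bs)"
  shows "walk_between T y v (y # bs)"
  using assms by (auto simp: walk_between_def successively_append_iff)

lemma walk_between_shortcut:
  assumes "walk_between T u v (as @ y # bs @ y # cs)"
  shows "walk_between T u v (as @ y # cs)"
  using assms by (cases as) (auto simp: walk_between_def successively_append_iff successively_Cons hd_append split: if_splits)

lemma walk_crossing:
  assumes "walk_between T u v xs" "u \<in> S" "v \<notin> S"
  obtains a b where "a \<in> S" "b \<notin> S" "adj T a b" "a \<in> set xs" "b \<in> set xs"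
  using assms
proof (induction xs arbitrary: u thesis)
  case Nil then show ?case by (simp add: walk_between_def)
next
  case (Cons x xs)
  from Cons.prems have ne: "xs \<noteq> []" and x: "x = u" and a: "adj T u (hd xs)" "walk_between T (hd xs) v xs"
    by (auto simp: walk_between_Cons split: if_splits)
  show ?case
  proof (cases "hd xs \<in> S")
    case True
    show ?thesis by (rule Cons.IH[OF _ a(2) True Cons.prems(4)]) (auto intro: Cons.prems(1))
  next
    case False
    show ?thesis by (rule Cons.prems(1)[of u "hd xs"]) (use Cons.prems False a x ne in auto)
  qed
qed

lemma gdist_le: "walk_between T u v xs \<Longrightarrow> gdist T u v \<le> length xs - 1"
  unfolding gdist_def by (rule Least_le) (auto simp: walk_between_def intro!: exI[of _ xs])

lemma gdist_walk:
  assumes "walk_between T u v xs"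
  obtains ys where "walk_between T u v ys" "length ys = Suc (gdist T u v)"
proof -
  have "\<exists>xs. walk_between T u v xs \<and> length xs = Suc (gdist T u v)"
    unfolding gdist_def
    by (rule LeastI[of _ "length xs - 1"]) (use assms in \<open>auto simp: walk_between_def intro!: exI[of _ xs]\<close>)
  then show ?thesis using that by blast
qed

text \<open>A repeated vertex would allow the loop between its two visits to be cut out, leaving a
  shorter walk.\<close>

lemma shortest_walk_distinct:
  assumes "walk_between T u v ys" "length ys = Suc (gdist T u v)"
  shows "distinct ys"
proof (rule ccontr)
  assume "\<not> distinct ys"
  then obtain as y bs cs where "ys = as @ [y] @ bs @ [y] @ cs"
    using not_distinct_decomp by blast
  then have *: "ys = as @ y # bs @ y # cs" by simp
  from walk_between_shortcut[OF assms(1)[unfolded *]] have "gdist T u v \<le> length (as @ y # cs) - 1"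
    by (rule gdist_le)
  with assms(2) * show False by simp
qed

lemma gdist_self: "u \<in> verts T \<Longrightarrow> gdist T u u = 0"
  using gdist_le[of T u u "[u]"] by (simp add: walk_between_def)

lemma gdist_eq_0:
  assumes "walk_between T u v xs" "gdist T u v = 0" shows "u = v"
proof -
  obtain ys where "walk_between T u v ys" "length ys = Suc (gdist T u v)"
    using gdist_walk[OF assms(1)] .
  with assms(2) show ?thesis by (auto simp: length_Suc_conv walk_between_def)
qed

lemma gdist_adj_le:
  assumes "adj T u w" "u \<in> verts T" "walk_between T w v xs"
  shows "gdist T u v \<le> Suc (gdist T w v)"
proof -
  obtain ys where ys: "walk_between T w v ys" "length ys = Suc (gdist T w v)"
    using gdist_walk[OF assms(3)] .
  from gdist_le[OF walk_between_adj[OF assms(1,2) ys(1)]] ys(2) show ?thesis by simp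
qed

text \<open>A shortest walk from \<open>u\<close> to \<open>v\<close> meets \<open>w\<close>; its
  part from \<open>w\<close> on is strictly shorter because \<open>u \<noteq> w\<close>.\<close>

lemma gdist_gt:
  assumes "walk_between T u v xs"
    and "\<And>xs. walk_between T u v xs \<Longrightarrow> w \<in> set xs" "u \<noteq> w"
  shows "gdist T w v < gdist T u v"
proof -
  obtain ys where ys: "walk_between T u v ys" "length ys = Suc (gdist T u v)"
    using gdist_walk[OF assms(1)] .
  from assms(2)[OF ys(1)] obtain as bs where *: "ys = as @ w # bs"
    by (auto dest: split_list)
  have "as \<noteq> []" using ys(1) * assms(3) by (auto simp: walk_between_def)
  moreover have "gdist T w v \<le> length (w # bs) - 1"
    by (rule gdist_le, rule walk_between_suffix) (use ys(1) * in simp)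
  moreover have "0 < length as" using \<open>as \<noteq> []\<close> by simp
  moreover have "length ys = length as + Suc (length bs)" using * by simp
  ultimately show ?thesis using ys(2) by (simp del: length_greater_0_conv)
qed

lemma gdist_eq_1:
  assumes "walk_between T u v xs" "u \<noteq> v"
  shows "gdist T u v = 1 \<longleftrightarrow> adj T u v"
proof
  assume 1: "gdist T u v = 1"
  obtain ys where "walk_between T u v ys" "length ys = Suc (gdist T u v)"
    using gdist_walk[OF assms(1)] .
  with 1 show "adj T u v" by (auto simp: length_Suc_conv walk_between_def)
next
  assume a: "adj T u v"
  have "v \<in> verts T" "u \<in> verts T" using assms(1) by (auto simp: walk_between_def)
  with a have "walk_between T u v [u, v]" by (simp add: walk_between_def)
  from gdist_le[OF this] gdist_eq_0[OF assms(1)] assms(2)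
  show "gdist T u v = 1" by (cases "gdist T u v") auto
qed

section \<open>Parent maps, separation by an edge, and uniqueness of paths\<close>

definition parent_rtree :: "'v set \<Rightarrow> ('v \<Rightarrow> 'v) \<Rightarrow> 'v \<Rightarrow> 'v rtree" where
  "parent_rtree V par x = \<lparr>verts = V,
     adj = (\<lambda>u v. u \<in> V \<and> v \<in> V \<and> (par u = v \<or> par v = u)),
     ray = (\<lambda>n. (par ^^ n) x)\<rparr>"

text \<open>\<open>level\<close> is a horocyclic height towards the end of the ray; it is an integer
  because the ray climbs forever and branches may descend forever. It rules out cycles of
  \<open>par\<close> and separates generations, while \<open>common_ancestor\<close> supplies
  connectedness. No assumption mentions a root, so one instance serves all shifts of a tree.\<close>

locale parent_tree =
  fixes V :: "'v set" and par :: "'v \<Rightarrow> 'v" and level :: "'v \<Rightarrow> int"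
  assumes par_closed: "v \<in> V \<Longrightarrow> par v \<in> V"
    and level_par: "v \<in> V \<Longrightarrow> level (par v) = level v + 1"
    and common_ancestor: "u \<in> V \<Longrightarrow> v \<in> V \<Longrightarrow> \<exists>i j. (par ^^ i) u = (par ^^ j) v"
    and finite_children: "v \<in> V \<Longrightarrow> finite {w \<in> V. par w = v}"
begin

abbreviation "tree \<equiv> parent_rtree V par"

lemma tree_simps [simp]:
  "verts (tree x) = V"
  "adj (tree x) u v \<longleftrightarrow> u \<in> V \<and> v \<in> V \<and> (par u = v \<or> par v = u)"
  "ray (tree x) n = (par ^^ n) x"
  by (simp_all add: parent_rtree_def)

lemma funpow_par_closed: "v \<in> V \<Longrightarrow> (par ^^ n) v \<in> V"
  by (induction n) (auto simp: par_closed)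

lemma level_funpow: "v \<in> V \<Longrightarrow> level ((par ^^ n) v) = level v + int n"
  by (induction n) (auto simp: level_par funpow_par_closed)

lemma par_neq: "v \<in> V \<Longrightarrow> par v \<noteq> v"
  using level_par[of v] by auto

definition descendants :: "'v \<Rightarrow> 'v set" where
  "descendants x = {w \<in> V. \<exists>k. (par ^^ k) w = x}"

text \<open>The parent of a descendant of \<open>c\<close> is again a descendant, except for
  \<open>c\<close> itself, and children of descendants are descendants. Hence a single edge crosses
  the boundary.\<close>

lemma descendants_leave:
  assumes "adj (tree x) a b" "a \<in> descendants c" "b \<notin> descendants c"
  shows "a = c \<and> b = par c"
proof -
  obtain k where k: "(par ^^ k) a = c" using assms(2) by (auto simp: descendants_def)
  from assms(1) have ab: "a \<in> V" "b \<in> V" by auto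
  from assms(1) consider "par a = b" | "par b = a" by auto
  then show ?thesis
  proof cases
    case 1
    show ?thesis
    proof (cases k)
      case 0 with k 1 show ?thesis by simp
    next
      case (Suc j)
      with k 1 have "(par ^^ j) b = c" by (simp add: funpow_Suc_right del: funpow.simps)
      with ab assms(3) show ?thesis by (auto simp: descendants_def)
    qed
  next
    case 2
    with k have "(par ^^ Suc k) b = c" by (simp add: funpow_Suc_right del: funpow.simps)
    then have "b \<in> descendants c" unfolding descendants_def using ab by blast
    with assms(3) show ?thesis by simp
  qed
qed

lemma par_notin_descendants: "u \<in> V \<Longrightarrow> par u \<notin> descendants u"
proof
  assume u: "u \<in> V" and "par u \<in> descendants u"
  then obtain k where "(par ^^ k) (par u) = u" by (auto simp: descendants_def)
  then have "level ((par ^^ k) (par u)) = level u" by simp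
  with u show False by (simp add: level_funpow par_closed level_par)
qed

lemma descendants_trans:
  assumes "y \<in> descendants x" "par x = u"
  shows "y \<in> descendants u"
proof -
  obtain k where "(par ^^ k) y = x" "y \<in> V" using assms(1) by (auto simp: descendants_def)
  then have "(par ^^ Suc k) y = u" "y \<in> V" using assms(2) by simp_all
  then show ?thesis unfolding descendants_def by blast
qed

text \<open>The component of \<open>z\<close> after the edge between \<open>u\<close> and \<open>z\<close> is deleted.\<close>

definition side :: "'v \<Rightarrow> 'v \<Rightarrow> 'v set" where
  "side u z = (if par z = u then descendants z else V - descendants u)"

lemma side_ends:
  assumes "adj (tree x) u z"
  shows "z \<in> side u z" "u \<notin> side u z"
proof -
  have self: "w \<in> V \<Longrightarrow> w \<in> descendants w" for w
    by (auto simp: descendants_def intro!: exI[of _ 0])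
  show "z \<in> side u z" "u \<notin> side u z"
    using assms self par_notin_descendants by (auto simp: side_def)
qed

lemma side_leave:
  assumes e: "adj (tree x) u z" and ab: "adj (tree x) a b" "a \<in> side u z" "b \<notin> side u z"
  shows "a = z \<and> b = u"
proof (cases "par z = u")
  case True
  with descendants_leave[OF ab(1), of z] ab show ?thesis by (auto simp: side_def)
next
  case False
  with e have z: "par u = z" by auto
  have "adj (tree x) b a" using ab(1) by auto
  from descendants_leave[OF this, of u] ab False z show ?thesis by (auto simp: side_def)
qed

lemma side_disjoint:
  assumes "adj (tree x) u y" "adj (tree x) u z" "y \<noteq> z"
  shows "side u y \<inter> side u z = {}"
proof -
  have sib: "descendants y \<inter> descendants z = {}" if "par y = u" "par z = u"
  proof -
    \<comment> \<open>Siblings have equal level, so a common descendant would reach both after the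
      same number of steps, and they would coincide.\<close>
    have "level y = level z" using that assms level_par[of y] level_par[of z] by auto
    have False if "w \<in> V" "(par ^^ i) w = y" "(par ^^ j) w = z" for w i j
    proof -
      have "level y = level w + int i" "level z = level w + int j"
        using that level_funpow[of w] by auto
      with \<open>level y = level z\<close> have "i = j" by simp
      with that assms(3) show False by simp
    qed
    then show ?thesis by (auto simp: descendants_def)
  qed
  show ?thesis
    using assms sib descendants_trans by (auto simp: side_def)
qed

lemma walk_avoiding:
  assumes "adj (tree x) u z" "walk_between (tree x) z v xs" "u \<notin> set xs"
  shows "v \<in> side u z"
proof (rule ccontr)
  assume "v \<notin> side u z"
  then obtain a b where "a \<in> side u z" "b \<notin> side u z" "adj (tree x) a b" "b \<in> set xs"
    using walk_crossing[OF assms(2) side_ends(1)[OF assms(1)]] by blast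
  with side_leave[OF assms(1)] assms(3) show False by blast
qed

text \<open>A distinct walk never returns to \<open>u\<close>, so its first step enters the side of
  \<open>u\<close> that contains \<open>v\<close>. Sides of different neighbours are disjoint; hence
  the first steps agree, and induction handles the rest.\<close>

lemma distinct_walk_unique:
  assumes "walk_between (tree x) u v xs" "distinct xs" "walk_between (tree x) u v ys" "distinct ys"
  shows "xs = ys"
  using assms
proof (induction xs arbitrary: u ys)
  case Nil then show ?case by (simp add: walk_between_def)
next
  case (Cons a xs)
  have a: "a = u" using Cons.prems by (simp add: walk_between_Cons)
  obtain ys' where ys: "ys = u # ys'"
    using Cons.prems(3) by (cases ys) (auto simp: walk_between_def)
  have closed: "zs = []" if "walk_between (tree x) u u (u # zs)" "distinct (u # zs)" for zs
    using that by (auto simp: walk_between_def split: if_splits)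
  show ?case
  proof (cases "xs = [] \<or> ys' = []")
    case True
    then have "v = u" using Cons.prems a ys by (auto simp: walk_between_Cons)
    then have "u = v" "xs = []" "ys' = []" using closed[of xs] closed[of ys'] Cons.prems a ys by simp_all
    with a ys show ?thesis by simp
  next
    case False
    then have 1: "adj (tree x) u (hd xs)" "walk_between (tree x) (hd xs) v xs"
      and 2: "adj (tree x) u (hd ys')" "walk_between (tree x) (hd ys') v ys'"
      using Cons.prems ys by (simp_all add: walk_between_Cons split: if_splits)
    have "v \<in> side u (hd xs)" "v \<in> side u (hd ys')"
      using walk_avoiding[OF 1] walk_avoiding[OF 2] Cons.prems(2,4) a ys by auto
    with side_disjoint[OF 1(1) 2(1)] have eq: "hd xs = hd ys'" by blast
    have "xs = ys'"
      by (rule Cons.IH[OF 1(2)]) (use Cons.prems(2,4) 2(2) eq ys in auto)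
    then show ?thesis using a ys by simp
  qed
qed

text \<open>Climb from \<open>u\<close> to the common ancestor, then follow the ancestors of
  \<open>v\<close> backwards; the base case of the induction is the downward half.\<close>

lemma walk_from_common_ancestor:
  assumes "u \<in> V" "v \<in> V" "(par ^^ i) u = (par ^^ j) v"
  shows "\<exists>xs. walk_between (tree x) u v xs"
  using assms
proof (induction i arbitrary: u)
  case 0
  have "w \<in> V \<Longrightarrow> \<exists>xs. walk_between (tree x) ((par ^^ j) w) w xs" for w
  proof (induction j arbitrary: w)
    case 0 then show ?case by (auto simp: walk_between_def intro!: exI[of _ "[w]"])
  next
    case (Suc j)
    from Suc.IH[of "par w"] Suc.prems obtain xs
      where xs: "walk_between (tree x) ((par ^^ Suc j) w) (par w) xs"
      by (auto simp: par_closed funpow_Suc_right simp del: funpow.simps)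
    then have "walk_between (tree x) ((par ^^ Suc j) w) w (xs @ [w])"
      using Suc.prems by (auto simp: walk_between_def successively_append_iff par_closed)
    then show ?case by blast
  qed
  with 0 show ?case by simp
next
  case (Suc i)
  then have "\<exists>xs. walk_between (tree x) (par u) v xs"
    by (intro Suc.IH) (simp_all add: par_closed funpow_Suc_right del: funpow.simps)
  then obtain xs where "walk_between (tree x) (par u) v xs" ..
  from walk_between_adj[OF _ _ this, of u] Suc.prems show ?case by (auto simp: par_closed)
qed

lemma connected:
  assumes "u \<in> V" "v \<in> V"
  obtains xs where "walk_between (tree x) u v xs"
  using common_ancestor[OF assms] walk_from_common_ancestor[OF assms] that by blast

text \<open>By \<open>side_leave\<close> the vertex \<open>z\<close> is the only entrance to its
  side, so every walk from \<open>u\<close> to \<open>v\<close> passes through it.\<close>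

lemma gdist_side:
  assumes "adj (tree x) u z" "v \<in> side u z"
  shows "gdist (tree x) u v = Suc (gdist (tree x) z v)"
proof -
  have V: "u \<in> V" "z \<in> V" "v \<in> V"
    using assms by (auto simp: side_def descendants_def split: if_splits)
  obtain ws where ws: "walk_between (tree x) u v ws" using connected[OF V(1,3)] .
  obtain zs where zs: "walk_between (tree x) z v zs" using connected[OF V(2,3)] .
  have "z \<in> set xs" if xs: "walk_between (tree x) u v xs" for xs
  proof -
    obtain a b where ab: "a \<in> - side u z" "b \<notin> - side u z" "adj (tree x) a b" "b \<in> set xs"
      using walk_crossing[OF xs, of "- side u z"] side_ends[OF assms(1)] assms(2) by blast
    then have "adj (tree x) b a" by auto
    from side_leave[OF assms(1) this] ab show ?thesis by auto
  qed
  then have "gdist (tree x) z v < gdist (tree x) u v"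
    by (rule gdist_gt[OF ws]) (use side_ends[OF assms(1)] in auto)
  moreover have "gdist (tree x) u v \<le> Suc (gdist (tree x) z v)"
    by (rule gdist_adj_le[OF assms(1) _ zs]) (use V in simp)
  ultimately show ?thesis by simp
qed

lemma inj_funpow: "v \<in> V \<Longrightarrow> inj (\<lambda>n. (par ^^ n) v)"
proof (rule injI)
  fix i j assume v: "v \<in> V" and "(par ^^ i) v = (par ^^ j) v"
  then have "level ((par ^^ i) v) = level ((par ^^ j) v)" by simp
  with v show "i = j" by (simp add: level_funpow)
qed

lemma rayed_tree_tree:
  assumes "x \<in> V"
  shows "rayed_tree (tree x)"
  unfolding rayed_tree_def
proof (intro conjI allI ballI impI)
  have sub: "range (\<lambda>n. (par ^^ n) x) \<subseteq> V" using assms by (auto intro: funpow_par_closed)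
  show "infinite (verts (tree x))"
    using range_inj_infinite[OF inj_funpow[OF assms]] finite_subset[OF sub] by auto
  show "range (ray (tree x)) \<subseteq> verts (tree x)" using sub by simp
  have "ray (tree x) = (\<lambda>n. (par ^^ n) x)" by (rule ext) simp
  then show "inj (ray (tree x))" using inj_funpow[OF assms] by simp
  show "adj (tree x) (ray (tree x) n) (ray (tree x) (Suc n))" for n
    using assms by (simp add: funpow_par_closed par_closed)
  show "finite {w. adj (tree x) v w}" if "v \<in> verts (tree x)" for v
  proof -
    have "{w. adj (tree x) v w} \<subseteq> insert (par v) {w \<in> V. par w = v}" by auto
    moreover have "finite (insert (par v) {w \<in> V. par w = v})" using finite_children[of v] that by simp
    ultimately show ?thesis by (rule finite_subset)
  qed
  fix u v assume "u \<in> verts (tree x)" "v \<in> verts (tree x)"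
  then have "u \<in> V" "v \<in> V" by simp_all
  then obtain xs where "walk_between (tree x) u v xs" by (rule connected)
  then obtain ys where ys: "walk_between (tree x) u v ys" "length ys = Suc (gdist (tree x) u v)"
    by (rule gdist_walk)
  note ys(1) shortest_walk_distinct[OF ys]
  then show "\<exists>!xs. walk_between (tree x) u v xs \<and> distinct xs"
    by (intro ex1I[of _ ys] conjI) (auto intro: distinct_walk_unique)
qed (auto simp: par_neq)

lemma geodesic_walk:
  assumes "u \<in> V" "v \<in> V"
  shows "walk_between (tree x) u v (geodesic (tree x) u v)"
    and "length (geodesic (tree x) u v) = Suc (gdist (tree x) u v)"
proof -
  obtain xs where "walk_between (tree x) u v xs" using connected[OF assms] .
  then obtain ys where ys: "walk_between (tree x) u v ys" "length ys = Suc (gdist (tree x) u v)"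
    by (rule gdist_walk)
  have "geodesic (tree x) u v = ys"
    unfolding geodesic_def
  proof (rule the_equality)
    show "zs = ys" if "walk_between (tree x) u v zs \<and> length zs = Suc (gdist (tree x) u v)" for zs
      using that ys shortest_walk_distinct by (intro distinct_walk_unique) auto
  qed (use ys in simp)
  with ys show "walk_between (tree x) u v (geodesic (tree x) u v)"
    "length (geodesic (tree x) u v) = Suc (gdist (tree x) u v)" by simp_all
qed

section \<open>Offspring, parents and shifts in terms of the parent map\<close>

lemma ray_dist_ray:
  assumes "v \<in> V" "v \<in> range (ray (tree x))"
  shows "ray_dist (tree x) v = 0"
proof -
  obtain k where "v = (par ^^ k) x" using assms(2) by auto
  with assms(1) have "gdist (tree x) v (ray (tree x) k) = 0" by (simp add: gdist_self)
  then have "\<exists>k. gdist (tree x) v (ray (tree x) k) = 0" by blast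
  then show ?thesis unfolding ray_dist_def by (rule Least_eq_0)
qed

text \<open>No ray vertex descends from \<open>v\<close>, since its ancestors are on the ray and
  \<open>v\<close> is not. So the whole ray lies beyond the edge above \<open>v\<close>, and each
  distance to it drops by exactly one on moving to \<open>par v\<close>.\<close>

lemma ray_dist_off_ray:
  assumes "x \<in> V" "v \<in> V" "v \<notin> range (ray (tree x))"
  shows "ray_dist (tree x) v = Suc (ray_dist (tree x) (par v))"
proof -
  have "gdist (tree x) v (ray (tree x) k) = Suc (gdist (tree x) (par v) (ray (tree x) k))" for k
  proof (rule gdist_side)
    show "adj (tree x) v (par v)" using assms by (simp add: par_closed)
    have "(par ^^ k) x \<notin> descendants v"
    proof
      assume "(par ^^ k) x \<in> descendants v"
      then obtain j where "(par ^^ (j + k)) x = v" by (auto simp: descendants_def funpow_add)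
      then have "v = ray (tree x) (j + k)" by simp
      with assms(3) show False by blast
    qed
    moreover have "par (par v) \<noteq> v"
    proof
      assume "par (par v) = v"
      then have "level (par (par v)) = level v" by simp
      with assms(2) show False by (simp add: level_par par_closed)
    qed
    ultimately show "ray (tree x) k \<in> side v (par v)"
      using assms by (simp add: side_def funpow_par_closed)
  qed
  then have "ray_dist (tree x) v = (LEAST n. \<exists>k. Suc (gdist (tree x) (par v) (ray (tree x) k)) = n)"
    by (simp add: ray_dist_def)
  also have "\<dots> = Suc (LEAST n. \<exists>k. Suc (gdist (tree x) (par v) (ray (tree x) k)) = Suc n)"
    by (rule Least_Suc) auto
  finally show ?thesis by (simp add: ray_dist_def)
qed

text \<open>Both clauses of the metric definition reduce to the parent map. If the child is off the
  ray, its distance to the ray is one more than that of its parent. If it is on the ray, so is its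
  parent, both distances vanish, and the distance to the root decides, being larger at the
  parent.\<close>

lemma offspring_tree:
  assumes "x \<in> V" "v \<in> V"
  shows "offspring (tree x) v = {w \<in> V. par w = v}"
proof (intro set_eqI)
  fix w
  let ?T = "tree x"
  have dist1: "gdist ?T v w = 1 \<longleftrightarrow> par v = w \<or> par w = v" if w: "w \<in> V"
  proof (cases "v = w")
    case True with assms(2) show ?thesis by (auto simp: gdist_self par_neq)
  next
    case False
    obtain xs where "walk_between ?T v w xs" using connected[OF assms(2) w] .
    from gdist_eq_1[OF this False] show ?thesis using w assms(2) by simp
  qed
  have not2: "par (par w) \<noteq> w" if "w \<in> V" for w
  proof
    assume "par (par w) = w"
    then have "level (par (par w)) = level w" by simp
    with that show False by (simp add: level_par par_closed)
  qed
  have further: "gdist ?T (par w) x = Suc (gdist ?T w x)"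
    if "w \<in> V" "w \<in> range (ray ?T)" for w
  proof (rule gdist_side)
    show "adj ?T (par w) w" using that by (simp add: par_closed)
    show "x \<in> side (par w) w" using that assms(1) by (auto simp: side_def descendants_def)
  qed
  have ray_par: "par w \<in> range (ray ?T)" if "w \<in> range (ray ?T)" for w
  proof -
    from that obtain k where "w = (par ^^ k) x" by auto
    then have "par w = ray ?T (Suc k)" by simp
    then show ?thesis by blast
  qed
  show "w \<in> offspring ?T v \<longleftrightarrow> w \<in> {w \<in> V. par w = v}"
  proof (cases "w \<in> V \<and> (par v = w \<or> par w = v)")
    case False
    then show ?thesis using dist1 by (auto simp: offspring_def)
  next
    case True
    then have w: "w \<in> V" by simp
    from True consider "par w = v" | "par v = w" "par w \<noteq> v" by blast
    then show ?thesis
    proof cases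
      case 1
      have "w \<in> offspring ?T v"
      proof (cases "w \<in> range (ray ?T)")
        case True
        with further[OF w True] ray_par[OF True] 1 w assms dist1 show ?thesis
          by (auto simp: offspring_def)
      next
        case False
        from ray_dist_off_ray[OF assms(1) w this] 1 w assms dist1 show ?thesis
          by (simp add: offspring_def)
      qed
      with 1 w show ?thesis by simp
    next
      case 2
      have "w \<notin> offspring ?T v"
      proof (cases "v \<in> range (ray ?T)")
        case True
        with ray_par[OF True] further[OF assms(2) True] ray_dist_ray[of _ x] 2 w assms(2)
        show ?thesis by (simp add: offspring_def)
      next
        case False
        with ray_dist_off_ray[OF assms False] 2 show ?thesis by (simp add: offspring_def)
      qed
      with 2 show ?thesis by simp
    qed
  qed
qed

lemma offspring_outside: "v \<notin> V \<Longrightarrow> offspring (tree x) v = {}"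
  by (simp add: offspring_def)

lemma parent_tree_par:
  assumes "x \<in> V" "w \<in> V"
  shows "parent (tree x) w = par w"
  unfolding parent_def
proof (rule the_equality)
  show "w \<in> offspring (tree x) (par w)" using assms by (simp add: offspring_tree par_closed)
  show "v = par w" if "w \<in> offspring (tree x) v" for v
    using that assms offspring_tree[of x v] offspring_outside[of v x] by (cases "v \<in> V") auto
qed

text \<open>If \<open>v\<close> is the parent of \<open>x\<close>, erasing the first edge drops
  \<open>x\<close> from its line of ancestors. Otherwise \<open>v\<close> is a child, and putting it
  in front of the ray starts that line one step earlier.\<close>

lemma shift1_tree:
  assumes "x \<in> V" "adj (tree x) x v"
  shows "shift1 v (tree x) = tree v"
proof (cases "par x = v")
  case True
  then have "v = ray (tree x) 1" by simp
  then show ?thesis using True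
    by (auto simp: shift1_def parent_rtree_def fun_eq_iff funpow_Suc_right simp del: funpow.simps)
next
  case False
  with assms have x: "par v = x" by auto
  have "case_nat v (\<lambda>n. (par ^^ n) x) n = (par ^^ n) v" for n
    using x by (cases n) (simp_all add: funpow_Suc_right del: funpow.simps(2))
  then have "case_nat v (\<lambda>n. (par ^^ n) x) = (\<lambda>n. (par ^^ n) v)" by (rule ext)
  with False show ?thesis by (simp add: shift1_def parent_rtree_def)
qed

text \<open>Each intermediate tree is again of the form \<open>tree y\<close>, so only the endpoint
  of the walk matters.\<close>

lemma fold_shift1_walk:
  "walk_between (tree x) x v xs \<Longrightarrow> fold shift1 (tl xs) (tree x) = tree v"
proof (induction xs arbitrary: x)
  case Nil then show ?case by (simp add: walk_between_def)
next
  case (Cons a xs)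
  show ?case
  proof (cases xs)
    case Nil with Cons.prems show ?thesis by (simp add: walk_between_Cons)
  next
    case (Cons y ys)
    with Cons.prems have a: "adj (tree x) x y" "walk_between (tree x) y v (y # ys)"
      by (simp_all add: walk_between_Cons del: tree_simps)
    \<comment> \<open>Adjacency does not involve the ray, so the rest of the walk is still a walk
      after the shift.\<close>
    then have "walk_between (tree y) y v (y # ys)"
      by (simp add: walk_between_def parent_rtree_def)
    from Cons.IH[unfolded Cons, OF this] have "fold shift1 ys (tree y) = tree v" by simp
    with shift1_tree[OF _ a(1)] a(1) Cons show ?thesis by simp
  qed
qed

lemma shift_tree: "x \<in> V \<Longrightarrow> shift v (tree x) = (if v \<in> V then tree v else tree x)"
  using fold_shift1_walk[OF geodesic_walk(1)] by (auto simp: shift_def)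

end

section \<open>Isomorphisms and balls\<close>

lemma rt_iso_refl: "rt_iso T T"
  unfolding rt_iso_def by (rule exI[of _ id]) auto

lemma rt_iso_trans:
  assumes "rt_iso T S" "rt_iso S R" "range (ray T) \<subseteq> verts T"
  shows "rt_iso T R"
proof -
  obtain f where f: "bij_betw f (verts T) (verts S)"
    "\<And>u v. u \<in> verts T \<Longrightarrow> v \<in> verts T \<Longrightarrow> adj T u v \<longleftrightarrow> adj S (f u) (f v)"
    "\<And>n. f (ray T n) = ray S n"
    using assms(1) unfolding rt_iso_def by blast
  obtain g where g: "bij_betw g (verts S) (verts R)"
    "\<And>u v. u \<in> verts S \<Longrightarrow> v \<in> verts S \<Longrightarrow> adj S u v \<longleftrightarrow> adj R (g u) (g v)"
    "\<And>n. g (ray S n) = ray R n"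
    using assms(2) unfolding rt_iso_def by blast
  have "f u \<in> verts S" if "u \<in> verts T" for u using f(1) that by (rule bij_betw_apply)
  then show ?thesis
    unfolding rt_iso_def using bij_betw_trans[OF f(1) g(1)] f g by (intro exI[of _ "g \<circ> f"]) simp
qed

lemma iso_class_eqI:
  assumes "rt_iso T S" "rt_iso S T" "range (ray T) \<subseteq> verts T" "range (ray S) \<subseteq> verts S"
  shows "iso_class T = iso_class S"
  unfolding iso_class_def
  using rt_iso_trans[OF assms(1) _ assms(3)] rt_iso_trans[OF assms(2) _ assms(4)] by blast

lemma rball_iso_trans:
  assumes "rball_iso r T S" "rball_iso r S R"
  shows "rball_iso r T R"
proof -
  obtain f where f: "bij_betw f (rball T r) (rball S r)"
    "\<And>u v. u \<in> rball T r \<Longrightarrow> v \<in> rball T r \<Longrightarrow> adj T u v \<longleftrightarrow> adj S (f u) (f v)"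
    "\<And>n. n \<le> r \<Longrightarrow> f (ray T n) = ray S n"
    using assms(1) unfolding rball_iso_def by blast
  obtain g where g: "bij_betw g (rball S r) (rball R r)"
    "\<And>u v. u \<in> rball S r \<Longrightarrow> v \<in> rball S r \<Longrightarrow> adj S u v \<longleftrightarrow> adj R (g u) (g v)"
    "\<And>n. n \<le> r \<Longrightarrow> g (ray S n) = ray R n"
    using assms(2) unfolding rball_iso_def by blast
  have "f u \<in> rball S r" if "u \<in> rball T r" for u using f(1) that by (rule bij_betw_apply)
  then show ?thesis
    unfolding rball_iso_def using bij_betw_trans[OF f(1) g(1)] f g by (intro exI[of _ "g \<circ> f"]) simp
qed

lemma walk_between_map:
  assumes "walk_between T u v xs" "f ` verts T \<subseteq> verts S"
    and "\<And>u v. u \<in> verts T \<Longrightarrow> v \<in> verts T \<Longrightarrow> adj T u v \<Longrightarrow> adj S (f u) (f v)"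
  shows "walk_between S (f u) (f v) (map f xs)"
proof -
  have xs: "set xs \<subseteq> verts T" using assms(1) by (simp add: walk_between_def)
  have "successively (\<lambda>x y. adj S (f x) (f y)) xs"
    using assms(1) xs assms(3) unfolding walk_between_def
    by (auto elim!: successively_mono)
  with assms(1,2) show ?thesis
    unfolding walk_between_def by (auto simp: successively_map hd_map last_map)
qed

text \<open>The isomorphism and its inverse map walks to walks of the same length. Hence distances
  are preserved, and so are the balls around the roots.\<close>

lemma rt_iso_imp_rball_iso:
  assumes "rt_iso T S" "rayed_tree T" "rayed_tree S"
  shows "rball_iso r T S"
proof -
  obtain f where f: "bij_betw f (verts T) (verts S)"
    "\<And>u v. u \<in> verts T \<Longrightarrow> v \<in> verts T \<Longrightarrow> adj T u v \<longleftrightarrow> adj S (f u) (f v)"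
    "\<And>n. f (ray T n) = ray S n"
    using assms(1) unfolding rt_iso_def by blast
  define g where "g = inv_into (verts T) f"
  have gf: "g (f u) = u" if "u \<in> verts T" for u
    using that f(1) by (simp add: g_def bij_betw_def)
  have fg: "f (g w) = w" "g w \<in> verts T" if "w \<in> verts S" for w
    using that f(1) by (auto simp: g_def bij_betw_def f_inv_into_f inv_into_into)
  have fV: "f u \<in> verts S" if "u \<in> verts T" for u using f(1) that by (rule bij_betw_apply)
  have root: "ray T 0 \<in> verts T" using assms(2) unfolding rayed_tree_def by blast
  have "(\<exists>xs. walk_between T u v xs \<and> length xs = n) \<longleftrightarrow>
        (\<exists>xs. walk_between S (f u) (f v) xs \<and> length xs = n)"
    if uv: "u \<in> verts T" "v \<in> verts T" for u v n
  proof
    assume "\<exists>xs. walk_between T u v xs \<and> length xs = n"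
    then obtain xs where xs: "walk_between T u v xs" "length xs = n" by blast
    have "walk_between S (f u) (f v) (map f xs)"
      by (rule walk_between_map[OF xs(1)]) (use fV f(2) in auto)
    then show "\<exists>xs. walk_between S (f u) (f v) xs \<and> length xs = n"
      using xs(2) by (intro exI[of _ "map f xs"]) simp
  next
    assume "\<exists>xs. walk_between S (f u) (f v) xs \<and> length xs = n"
    then obtain xs where xs: "walk_between S (f u) (f v) xs" "length xs = n" by blast
    have "walk_between T (g (f u)) (g (f v)) (map g xs)"
      by (rule walk_between_map[OF xs(1)]) (use fg f(2) in auto)
    then show "\<exists>xs. walk_between T u v xs \<and> length xs = n"
      using gf uv xs(2) by (intro exI[of _ "map g xs"]) simp
  qed
  then have dist: "gdist S (f u) (f v) = gdist T u v" if "u \<in> verts T" "v \<in> verts T" for u v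
    using that by (simp add: gdist_def)
  have ball: "f ` rball T r = rball S r"
  proof (intro equalityI subsetI)
    fix w assume "w \<in> f ` rball T r"
    then show "w \<in> rball S r" using dist[OF root] fV f(3) by (auto simp: rball_def)
  next
    fix w assume w: "w \<in> rball S r"
    then have "w \<in> verts S" by (simp add: rball_def)
    from fg[OF this] dist[OF root, of "g w"] w f(3) have "g w \<in> rball T r"
      by (simp add: rball_def)
    then show "w \<in> f ` rball T r" using fg \<open>w \<in> verts S\<close> by force
  qed
  have "rball T r \<subseteq> verts T" by (auto simp: rball_def)
  with f(1) ball have "bij_betw f (rball T r) (rball S r)"
    by (auto simp: bij_betw_def intro: inj_on_subset)
  with f \<open>rball T r \<subseteq> verts T\<close> show ?thesis
    unfolding rball_iso_def by (intro exI[of _ f]) blast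
qed

text \<open>The last vertex before the end of a shortest walk lies in the next smaller ball, so
  local finiteness carries the induction. Finiteness matters later: only countably many sets of
  labels can occur as balls.\<close>

lemma finite_rball:
  assumes "rayed_tree T"
  shows "finite (rball T r)"
proof (induction r)
  case 0
  have "rball T 0 \<subseteq> {rt_root T}"
  proof
    fix v assume v: "v \<in> rball T 0"
    have "rt_root T \<in> verts T" using assms unfolding rayed_tree_def by blast
    moreover have "v \<in> verts T" using v by (simp add: rball_def)
    moreover have "\<forall>u\<in>verts T. \<forall>v\<in>verts T. \<exists>!xs. walk_between T u v xs \<and> distinct xs"
      using assms by (simp add: rayed_tree_def)
    ultimately obtain xs where "walk_between T (rt_root T) v xs" by (meson ex1_implies_ex)
    from gdist_eq_0[OF this] v show "v \<in> {rt_root T}" by (simp add: rball_def)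
  qed
  then show ?case by (rule finite_subset) simp
next
  case (Suc r)
  have "rball T (Suc r) \<subseteq> insert (rt_root T) (\<Union>u\<in>rball T r. {w. adj T u w})"
  proof
    fix v assume v: "v \<in> rball T (Suc r)"
    have "rt_root T \<in> verts T" using assms unfolding rayed_tree_def by blast
    moreover have "v \<in> verts T" using v by (simp add: rball_def)
    moreover have "\<forall>u\<in>verts T. \<forall>v\<in>verts T. \<exists>!xs. walk_between T u v xs \<and> distinct xs"
      using assms by (simp add: rayed_tree_def)
    ultimately obtain xs where "walk_between T (rt_root T) v xs" by (meson ex1_implies_ex)
    then obtain ys where ys: "walk_between T (rt_root T) v ys" "length ys = Suc (gdist T (rt_root T) v)"
      by (rule gdist_walk)
    then obtain zs where zs: "ys = zs @ [v]"
      unfolding walk_between_def by (metis append_butlast_last_id)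
    show "v \<in> insert (rt_root T) (\<Union>u\<in>rball T r. {w. adj T u w})"
    proof (cases "zs = []")
      case True with ys zs show ?thesis by (simp add: walk_between_def)
    next
      case False
      then have w: "walk_between T (rt_root T) (last zs) zs" "adj T (last zs) v"
        using ys(1) zs by (auto simp: walk_between_def successively_append_iff)
      have "length zs \<le> Suc r" using ys(2) zs v by (simp add: rball_def)
      with gdist_le[OF w(1)] have "gdist T (rt_root T) (last zs) \<le> r" by linarith
      moreover have "last zs \<in> verts T" using w(1) False by (auto simp: walk_between_def)
      ultimately show ?thesis using w(2) by (auto simp: rball_def)
    qed
  qed
  moreover have "finite (insert (rt_root T) (\<Union>u\<in>rball T r. {w. adj T u w}))"
    using Suc.IH assms by (auto simp: rayed_tree_def rball_def)
  ultimately show ?case by (rule finite_subset)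
qed

text \<open>Adjacency and ray are both built from the parent map, the ray as the iterates at the
  root, so a bijection that commutes with the parent maps preserves both.\<close>

lemma parent_rtree_rt_iso:
  assumes "parent_tree V par l" "parent_tree V' par' l'" "bij_betw f V V'"
    and com: "\<And>u. u \<in> V \<Longrightarrow> f (par u) = par' (f u)" and "x \<in> V"
  shows "rt_iso (parent_rtree V par x) (parent_rtree V' par' (f x))"
  unfolding rt_iso_def
proof (intro exI[of _ f] conjI ballI allI)
  interpret T: parent_tree V par l by fact
  interpret S: parent_tree V' par' l' by fact
  show "bij_betw f (verts (T.tree x)) (verts (S.tree (f x)))" using assms(3) by simp
  show "f (ray (T.tree x) n) = ray (S.tree (f x)) n" for n
    by (induction n) (auto simp: com T.funpow_par_closed \<open>x \<in> V\<close>)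
  have fV: "f u \<in> V'" if "u \<in> V" for u using assms(3) that by (rule bij_betw_apply)
  have "par u = v \<longleftrightarrow> par' (f u) = f v" if "u \<in> V" "v \<in> V" for u v
    using that com assms(3) T.par_closed by (auto simp: bij_betw_def inj_on_def)
  then show "adj (T.tree x) u v \<longleftrightarrow> adj (S.tree (f x)) (f u) (f v)"
    if "u \<in> verts (T.tree x)" "v \<in> verts (T.tree x)" for u v
    using that fV by simp
qed

section \<open>Transition probabilities of the biased walk\<close>

context parent_tree
begin

abbreviation children :: "'v \<Rightarrow> 'v set" where
  "children v \<equiv> {w \<in> V. par w = v}"

text \<open>The weights sum to one because the parent is not an offspring. A \<open>v\<close>
  outside \<open>V\<close> is covered too: it has no offspring, and all mass sits at the default
  value of \<open>parent\<close>. So measurability in \<omega> can later be checked at a fixed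
  label, whether or not it belongs to the tree.\<close>

lemma pmf_step:
  assumes "0 < lam" "x \<in> V"
  shows "pmf (step lam (tree x) v) w =
    (if w = parent (tree x) v then lam / (lam + real (outdeg (tree x) v))
     else if w \<in> offspring (tree x) v then 1 / (lam + real (outdeg (tree x) v)) else 0)"
proof -
  let ?T = "tree x"
  let ?d = "outdeg ?T v"
  let ?f = "\<lambda>w. if w = parent ?T v then lam / (lam + real ?d)
     else if w \<in> offspring ?T v then 1 / (lam + real ?d) else 0"
  have fin: "finite (offspring ?T v)"
    using finite_children offspring_tree[OF assms(2)] offspring_outside by (cases "v \<in> V") auto
  have par: "parent ?T v \<notin> offspring ?T v"
  proof (cases "v \<in> V")
    case True
    then have "par (par v) \<noteq> v" using level_par[of v] level_par[of "par v"] par_closed by force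
    with True assms show ?thesis by (simp add: offspring_tree parent_tree_par)
  qed (simp add: offspring_outside)
  have "(\<integral>\<^sup>+w. ennreal (?f w) \<partial>count_space UNIV) = (\<Sum>w\<in>insert (parent ?T v) (offspring ?T v). ennreal (?f w))"
    by (rule nn_integral_count_space') (use fin in auto)
  also have "\<dots> = ennreal (\<Sum>w\<in>insert (parent ?T v) (offspring ?T v). ?f w)"
    using assms by (intro sum_ennreal) auto
  also have "(\<Sum>w\<in>insert (parent ?T v) (offspring ?T v). ?f w) =
      lam / (lam + real ?d) + (\<Sum>w\<in>offspring ?T v. 1 / (lam + real ?d))"
  proof (subst sum.insert[OF fin par])
    have "(\<Sum>w\<in>offspring ?T v. ?f w) = (\<Sum>w\<in>offspring ?T v. 1 / (lam + real ?d))"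
      using par by (intro sum.cong refl) auto
    then show "?f (parent ?T v) + (\<Sum>w\<in>offspring ?T v. ?f w) =
      lam / (lam + real ?d) + (\<Sum>w\<in>offspring ?T v. 1 / (lam + real ?d))" by simp
  qed
  also have "\<dots> = 1"
  proof -
    have "lam + real ?d > 0" using assms by simp
    then have "lam / (lam + real ?d) + real ?d / (lam + real ?d) = 1"
      by (simp add: add_divide_distrib[symmetric])
    then show ?thesis by (simp add: outdeg_def)
  qed
  finally show ?thesis
    unfolding step_def using assms by (subst pmf_embed_pmf) auto
qed

lemma nn_integral_step:
  assumes "0 < lam" "x \<in> V" "v \<in> V"
  shows "(\<integral>\<^sup>+w. h w \<partial>measure_pmf (step lam (tree x) v)) =
    ennreal (lam / (lam + real (card (children v)))) * h (par v) +
    (\<Sum>w\<in>children v. ennreal (1 / (lam + real (card (children v)))) * h w)"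
proof -
  let ?d = "card (children v)"
  have par: "par v \<notin> children v"
    using level_par[of v] level_par[of "par v"] par_closed assms(3) by force
  have pmf: "pmf (step lam (tree x) v) w =
    (if w = par v then lam / (lam + real ?d) else if w \<in> children v then 1 / (lam + real ?d) else 0)" for w
    using assms by (simp add: pmf_step parent_tree_par offspring_tree outdeg_def)
  have "(\<integral>\<^sup>+w. h w \<partial>measure_pmf (step lam (tree x) v)) =
      (\<Sum>w\<in>insert (par v) (children v). ennreal (pmf (step lam (tree x) v) w) * h w)"
    unfolding nn_integral_measure_pmf
    by (rule nn_integral_count_space') (use finite_children assms(3) pmf in auto)
  also have "\<dots> = ennreal (pmf (step lam (tree x) v) (par v)) * h (par v) +
      (\<Sum>w\<in>children v. ennreal (pmf (step lam (tree x) v) w) * h w)"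
    using par finite_children assms(3) by (subst sum.insert) auto
  also have "(\<Sum>w\<in>children v. ennreal (pmf (step lam (tree x) v) w) * h w) =
      (\<Sum>w\<in>children v. ennreal (1 / (lam + real ?d)) * h w)"
    using par by (intro sum.cong refl) (auto simp: pmf)
  finally show ?thesis by (simp add: pmf)
qed

end

section \<open>Labelled trees\<close>

fun par_label :: "label \<Rightarrow> label" where
  "par_label (n, ks) = (if ks = [] then (Suc n, []) else (n, butlast ks))"

fun level_label :: "label \<Rightarrow> int" where
  "level_label (n, ks) = int n - int (length ks)"

lemma child_label_iff: "child_label u v \<longleftrightarrow> par_label v = u"
proof (cases v)
  case (Pair n ks)
  show ?thesis
  proof (cases ks rule: rev_cases)
    case Nil then show ?thesis using Pair by (auto simp: child_label_def)
  next
    case (snoc js j) then show ?thesis using Pair by (auto simp: child_label_def)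
  qed
qed

lemma ray_in_tree_labels [simp]: "(n, []) \<in> tree_labels \<omega>"
  by (simp add: tree_labels_def)

lemma snoc_in_tree_labels:
  "(n, ks @ [i]) \<in> tree_labels \<omega> \<longleftrightarrow> (n, ks) \<in> tree_labels \<omega> \<and> i < off_ray_children \<omega> (n, ks)"
  by (auto simp: tree_labels_def nth_append less_Suc_eq simp del: off_ray_children.simps)

lemma tree_labels_children:
  assumes "(n, ks) \<in> tree_labels \<omega>"
  shows "{w \<in> tree_labels \<omega>. par_label w = (n, ks)} =
    (\<lambda>i. (n, ks @ [i])) ` {..<off_ray_children \<omega> (n, ks)} \<union> (if ks = [] \<and> n \<noteq> 0 then {(n - 1, [])} else {})"
    (is "?L = ?R")
proof (intro set_eqI)
  fix w :: label
  obtain k js where w: "w = (k, js)" by (cases w)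
  show "w \<in> ?L \<longleftrightarrow> w \<in> ?R"
    using assms unfolding w
    by (cases js rule: rev_cases) (auto simp: snoc_in_tree_labels simp del: off_ray_children.simps)
qed

lemma funpow_par_label_root: "(par_label ^^ k) (n, []) = (n + k, [])"
  by (induction k) auto

lemma funpow_par_label: "(par_label ^^ length ks) (n, ks) = (n, [])"
proof (induction ks rule: rev_induct)
  case (snoc i ks)
  then show ?case by (simp add: funpow_Suc_right del: funpow.simps)
qed simp

lemma parent_tree_labels: "parent_tree (tree_labels \<omega>) par_label level_label"
proof
  fix v :: label
  obtain n ks where v: "v = (n, ks)" by (cases v)
  show "par_label v \<in> tree_labels \<omega>" if "v \<in> tree_labels \<omega>"
    using that v by (cases ks rule: rev_cases) (auto simp: snoc_in_tree_labels)
  show "level_label (par_label v) = level_label v + 1"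
    using v by (cases ks rule: rev_cases) auto
  show "finite {w \<in> tree_labels \<omega>. par_label w = v}" if "v \<in> tree_labels \<omega>"
    using that unfolding v by (subst tree_labels_children) auto
  show "\<exists>i j. (par_label ^^ i) u = (par_label ^^ j) v" for u
  proof -
    obtain m js where u: "u = (m, js)" by (cases u)
    \<comment> \<open>Both vertices are lifted to the ray vertex with index \<open>m + n\<close>:
      here \<open>length js\<close> steps reach the ray and \<open>n\<close> more follow it.\<close>
    have "(par_label ^^ (n + length js)) u = (m + n, [])"
      unfolding funpow_add u o_apply funpow_par_label by (simp add: funpow_par_label_root)
    moreover have "(par_label ^^ (m + length ks)) v = (n + m, [])"
      unfolding funpow_add v o_apply funpow_par_label by (simp add: funpow_par_label_root)
    ultimately show ?thesis by (metis add.commute)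
  qed
qed

lemma tree_of_eq: "tree_of \<omega> = parent_rtree (tree_labels \<omega>) par_label (0, [])"
  by (auto simp: tree_of_def parent_rtree_def child_label_iff funpow_par_label_root fun_eq_iff)

interpretation labels: parent_tree "tree_labels \<omega>" par_label level_label for \<omega>
  by (rule parent_tree_labels)

definition view :: "(label \<Rightarrow> nat) \<times> label \<Rightarrow> label rtree set" where
  "view s = (case s of (\<omega>, v) \<Rightarrow> iso_class (shift v (tree_of \<omega>)))"

lemma environment_view: "environment t h = view (h t)"
  by (simp add: environment_def view_def)

lemma view_eq:
  "view (\<omega>, v) = iso_class (labels.tree \<omega> (if v \<in> tree_labels \<omega> then v else (0, [])))"
  by (simp add: view_def tree_of_eq labels.shift_tree)

text \<open>The ray of the tree shifted to \<open>v\<close> is the line of ancestors of \<open>v\<close>, so bijections that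
  commute with the parent map and match the roots are isomorphisms of the shifted trees.\<close>

definition same_view :: "(label \<Rightarrow> nat) \<times> label \<Rightarrow> (label \<Rightarrow> nat) \<times> label \<Rightarrow> bool" where
  "same_view = (\<lambda>(\<omega>, v) (\<omega>', v'). v \<in> tree_labels \<omega> \<and> (\<exists>f. bij_betw f (tree_labels \<omega>) (tree_labels \<omega>') \<and>
     (\<forall>u\<in>tree_labels \<omega>. f (par_label u) = par_label (f u)) \<and> f v = v'))"

lemma same_viewE:
  assumes "same_view s s'"
  obtains \<omega> v \<omega>' v' f where "s = (\<omega>, v)" "s' = (\<omega>', v')" "v \<in> tree_labels \<omega>"
    "bij_betw f (tree_labels \<omega>) (tree_labels \<omega>')"
    "\<And>u. u \<in> tree_labels \<omega> \<Longrightarrow> f (par_label u) = par_label (f u)" "f v = v'"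
proof (cases s, cases s')
  fix \<omega> v \<omega>' v' assume "s = (\<omega>, v)" "s' = (\<omega>', v')"
  with assms that show thesis unfolding same_view_def prod.case by blast
qed

definition view_invariant :: "((label \<Rightarrow> nat) \<times> label \<Rightarrow> 'a) \<Rightarrow> bool" where
  "view_invariant F \<longleftrightarrow> (\<forall>s s'. same_view s s' \<longrightarrow> F s = F s')"

lemma view_invariant_view: "view_invariant view"
  unfolding view_invariant_def
proof (intro allI impI)
  fix s s' :: "(label \<Rightarrow> nat) \<times> label"
  assume "same_view s s'"
  then obtain \<omega> v \<omega>' v' f where s: "s = (\<omega>, v)" "s' = (\<omega>', v')" and v: "v \<in> tree_labels \<omega>"
    and f: "bij_betw f (tree_labels \<omega>) (tree_labels \<omega>')"
      "\<And>u. u \<in> tree_labels \<omega> \<Longrightarrow> f (par_label u) = par_label (f u)" "f v = v'"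
    by (rule same_viewE) blast
  define g where "g = inv_into (tree_labels \<omega>) f"
  have gf: "g (f u) = u" if "u \<in> tree_labels \<omega>" for u
    using that f(1) by (simp add: g_def bij_betw_def)
  have fg: "f (g w) = w" "g w \<in> tree_labels \<omega>" if "w \<in> tree_labels \<omega>'" for w
    using that f(1) by (auto simp: g_def bij_betw_def f_inv_into_f inv_into_into)
  have g: "bij_betw g (tree_labels \<omega>') (tree_labels \<omega>)"
    unfolding g_def by (rule bij_betw_inv_into[OF f(1)])
  have gpar: "g (par_label w) = par_label (g w)" if "w \<in> tree_labels \<omega>'" for w
  proof -
    have "par_label w = f (par_label (g w))" using fg[OF that] f(2) by simp
    then show ?thesis using gf labels.par_closed fg[OF that] by simp
  qed
  have v': "v' \<in> tree_labels \<omega>'" using bij_betw_apply[OF f(1) v] f(3) by simp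
  have "rt_iso (labels.tree \<omega> v) (labels.tree \<omega>' (f v))"
    by (rule parent_rtree_rt_iso[OF parent_tree_labels parent_tree_labels f(1,2) v])
  moreover have "rt_iso (labels.tree \<omega>' v') (labels.tree \<omega> (g v'))"
    by (rule parent_rtree_rt_iso[OF parent_tree_labels parent_tree_labels g gpar v'])
  moreover have "g v' = v" using gf[OF v] unfolding f(3) .
  moreover have "range (ray (labels.tree \<omega> u)) \<subseteq> verts (labels.tree \<omega> u)" if "u \<in> tree_labels \<omega>" for u \<omega>
    using labels.funpow_par_closed[OF that] by auto
  ultimately have "iso_class (labels.tree \<omega> v) = iso_class (labels.tree \<omega>' v')"
    unfolding f(3) using v v' by (metis iso_class_eqI)
  then show "view s = view s'" using s v v' by (simp add: view_eq)
qed

definition walk_op :: "real \<Rightarrow> ((label \<Rightarrow> nat) \<times> label \<Rightarrow> ennreal) \<Rightarrow> (label \<Rightarrow> nat) \<times> label \<Rightarrow> ennreal" where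
  "walk_op lam F = (\<lambda>(\<omega>, v). \<integral>\<^sup>+w. F (\<omega>, w) \<partial>measure_pmf (step lam (tree_of \<omega>) v))"

lemma walk_op_eq:
  assumes "0 < lam" "v \<in> tree_labels \<omega>"
  shows "walk_op lam F (\<omega>, v) =
    ennreal (lam / (lam + real (card (labels.children \<omega> v)))) * F (\<omega>, par_label v) +
    (\<Sum>w\<in>labels.children \<omega> v. ennreal (1 / (lam + real (card (labels.children \<omega> v)))) * F (\<omega>, w))"
  using assms by (simp add: walk_op_def tree_of_eq labels.nn_integral_step)

text \<open>The bijection maps the children of \<open>v\<close> onto those of \<open>v'\<close> and
  the parent to the parent. So the two steps have the same weights, attached to positions with the
  same view.\<close>

lemma view_invariant_walk_op:
  assumes lam: "0 < lam" and F: "view_invariant F"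
  shows "view_invariant (walk_op lam F)"
  unfolding view_invariant_def
proof (intro allI impI)
  fix s s' :: "(label \<Rightarrow> nat) \<times> label"
  assume "same_view s s'"
  then obtain \<omega> v \<omega>' v' f where s: "s = (\<omega>, v)" "s' = (\<omega>', v')" and v: "v \<in> tree_labels \<omega>"
    and f: "bij_betw f (tree_labels \<omega>) (tree_labels \<omega>')"
      "\<And>u. u \<in> tree_labels \<omega> \<Longrightarrow> f (par_label u) = par_label (f u)" "f v = v'"
    by (rule same_viewE) blast
  have v': "v' \<in> tree_labels \<omega>'" using bij_betw_apply[OF f(1) v] f(3) by simp
  have eq: "F (\<omega>, u) = F (\<omega>', f u)" if "u \<in> tree_labels \<omega>" for u
  proof -
    have "same_view (\<omega>, u) (\<omega>', f u)" unfolding same_view_def using that f by auto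
    with F show ?thesis unfolding view_invariant_def by blast
  qed
  have ch: "bij_betw f (labels.children \<omega> v) (labels.children \<omega>' v')"
    unfolding bij_betw_def
  proof
    show "inj_on f (labels.children \<omega> v)" using f(1) by (auto simp: bij_betw_def intro: inj_on_subset)
    show "f ` labels.children \<omega> v = labels.children \<omega>' v'"
    proof (intro equalityI subsetI)
      fix w assume "w \<in> f ` labels.children \<omega> v"
      then obtain u where u: "u \<in> tree_labels \<omega>" "par_label u = v" "w = f u" by blast
      then show "w \<in> labels.children \<omega>' v'" using f(2)[OF u(1)] f(3) bij_betw_apply[OF f(1)] by auto
    next
      fix w assume w: "w \<in> labels.children \<omega>' v'"
      then have "w \<in> f ` tree_labels \<omega>" using f(1) by (simp add: bij_betw_def)
      then obtain u where u: "u \<in> tree_labels \<omega>" "w = f u" by blast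
      have "f (par_label u) = f v" using f(2)[OF u(1)] u w f(3) by simp
      then have "par_label u = v" using f(1) u v labels.par_closed by (auto simp: bij_betw_def inj_on_def)
      with u show "w \<in> f ` labels.children \<omega> v" by blast
    qed
  qed
  have "(\<Sum>w\<in>labels.children \<omega>' v'. c * F (\<omega>', w)) = (\<Sum>w\<in>labels.children \<omega> v. c * F (\<omega>, w))" for c
    unfolding sum.reindex_bij_betw[OF ch, symmetric] by (intro sum.cong refl) (simp add: eq)
  moreover have "F (\<omega>', par_label v') = F (\<omega>, par_label v)"
    using eq[of "par_label v"] f(2)[OF v] f(3) labels.par_closed[OF v] by simp
  ultimately show "walk_op lam F s = walk_op lam F s'"
    unfolding s using lam v v' bij_betw_same_card[OF ch] by (simp add: walk_op_eq)
qed

lemma view_invariant_times: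
  fixes F G :: "(label \<Rightarrow> nat) \<times> label \<Rightarrow> ennreal"
  assumes "view_invariant F" "view_invariant G"
  shows "view_invariant (\<lambda>s. F s * G s)"
  unfolding view_invariant_def
proof (intro allI impI)
  fix s s' :: "(label \<Rightarrow> nat) \<times> label"
  assume "same_view s s'"
  with assms have "F s = F s'" "G s = G s'" unfolding view_invariant_def by blast+
  then show "F s * G s = F s' * G s'" by simp
qed

section \<open>Measurability of the shifted tree\<close>

abbreviation offspring_space :: "(label \<Rightarrow> nat) measure" where
  "offspring_space \<equiv> \<Pi>\<^sub>M v\<in>UNIV. count_space UNIV"

lemma measurable_component [measurable]: "(\<lambda>\<omega>. \<omega> v) \<in> offspring_space \<rightarrow>\<^sub>M count_space UNIV"
  by (rule measurable_component_singleton) simp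

lemma measurable_off_ray_children [measurable]:
  "(\<lambda>\<omega>. off_ray_children \<omega> l) \<in> offspring_space \<rightarrow>\<^sub>M count_space UNIV"
proof (cases l)
  case (Pair n ks)
  show ?thesis unfolding Pair off_ray_children.simps
    by (rule measurable_compose[OF measurable_component[of "(n, ks)"],
          of "\<lambda>k. if ks = [] \<and> n \<noteq> 0 then k - 1 else k"]) simp
qed

lemma pred_tree_labels [measurable]: "Measurable.pred offspring_space (\<lambda>\<omega>. v \<in> tree_labels \<omega>)"
proof (cases v)
  case (Pair n ks)
  have "(\<lambda>\<omega>. v \<in> tree_labels \<omega>) = (\<lambda>\<omega>. \<forall>j\<in>{..<length ks}. ks ! j < off_ray_children \<omega> (n, take j ks))"
    unfolding Pair tree_labels_def by auto
  then show ?thesis by (simp only:) measurable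
qed

text \<open>In this form \<omega> enters only through the membership of finitely many labels for
  each list, and there are countably many lists; measurability is then automatic.\<close>

lemma in_rball_tree_iff:
  assumes "x \<in> tree_labels \<omega>"
  shows "y \<in> rball (labels.tree \<omega> x) r \<longleftrightarrow>
    (\<exists>xs. length xs \<le> Suc r \<and> xs \<noteq> [] \<and> hd xs = x \<and> last xs = y \<and>
      successively (\<lambda>u v. par_label u = v \<or> par_label v = u) xs \<and> (\<forall>u\<in>set xs. u \<in> tree_labels \<omega>))"
    (is "_ \<longleftrightarrow> (\<exists>xs. ?P xs)")
proof -
  let ?T = "labels.tree \<omega> x"
  have W: "walk_between ?T x y xs \<and> length xs \<le> Suc r \<longleftrightarrow> ?P xs" for xs
  proof -
    have "successively (adj ?T) xs \<longleftrightarrow> successively (\<lambda>u v. par_label u = v \<or> par_label v = u) xs"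
      if "set xs \<subseteq> tree_labels \<omega>"
      using that by (intro successively_cong) auto
    then show ?thesis unfolding walk_between_def by auto
  qed
  have "y \<in> rball ?T r \<longleftrightarrow> (\<exists>xs. walk_between ?T x y xs \<and> length xs \<le> Suc r)"
  proof
    assume y: "y \<in> rball ?T r"
    then have "y \<in> tree_labels \<omega>" by (simp add: rball_def)
    from labels.geodesic_walk[OF assms this, of x] y
    show "\<exists>xs. walk_between ?T x y xs \<and> length xs \<le> Suc r" by (auto simp: rball_def)
  next
    assume "\<exists>xs. walk_between ?T x y xs \<and> length xs \<le> Suc r"
    then obtain xs where xs: "walk_between ?T x y xs" "length xs \<le> Suc r" by blast
    have "y \<in> verts ?T" using xs(1) by (auto simp: walk_between_def simp del: labels.tree_simps)
    with gdist_le[OF xs(1)] xs(2) show "y \<in> rball ?T r" by (simp add: rball_def)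
  qed
  then show ?thesis unfolding W .
qed

lemma pred_in_rball:
  "Measurable.pred offspring_space (\<lambda>\<omega>. x \<in> tree_labels \<omega> \<and> y \<in> rball (labels.tree \<omega> x) r)"
  by (simp only: in_rball_tree_iff cong: conj_cong) measurable

lemma pred_rball_eq:
  "Measurable.pred offspring_space (\<lambda>\<omega>. x \<in> tree_labels \<omega> \<and> rball (labels.tree \<omega> x) r = B)"
proof -
  have eq: "(\<lambda>\<omega>. x \<in> tree_labels \<omega> \<and> rball (labels.tree \<omega> x) r = B) =
    (\<lambda>\<omega>. x \<in> tree_labels \<omega> \<and> (\<forall>y. (x \<in> tree_labels \<omega> \<and> y \<in> rball (labels.tree \<omega> x) r) \<longleftrightarrow> y \<in> B))"
    by auto
  show ?thesis unfolding eq using pred_in_rball[measurable] by measurable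
qed

text \<open>Adjacency of two labels that are present does not depend on \<omega>. Once the ball is
  known as a set \<open>B\<close> of labels, the isomorphism is therefore a property
  \<open>Q\<close> of \<open>B\<close> alone. The finite sets \<open>B\<close> are enumerated by
  lists, so the event is a countable union.\<close>

lemma pred_rball_iso:
  "Measurable.pred offspring_space (\<lambda>\<omega>. x \<in> tree_labels \<omega> \<and> rball_iso r (labels.tree \<omega> x) S)"
proof -
  define Q where "Q B \<longleftrightarrow> (\<exists>f. bij_betw f B (rball S r) \<and>
     (\<forall>u\<in>B. \<forall>v\<in>B. (par_label u = v \<or> par_label v = u) \<longleftrightarrow> adj S (f u) (f v)) \<and>
     (\<forall>n\<le>r. f ((par_label ^^ n) x) = ray S n))" for B
  have Q: "rball_iso r (labels.tree \<omega> x) S \<longleftrightarrow> Q (rball (labels.tree \<omega> x) r)" for \<omega>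
  proof -
    have "u \<in> tree_labels \<omega>" if "u \<in> rball (labels.tree \<omega> x) r" for u
      using that by (simp add: rball_def)
    then show ?thesis unfolding rball_iso_def Q_def by (simp cong: ball_cong)
  qed
  have "x \<in> tree_labels \<omega> \<and> rball_iso r (labels.tree \<omega> x) S \<longleftrightarrow>
    (\<exists>B. Q (set B) \<and> (x \<in> tree_labels \<omega> \<and> rball (labels.tree \<omega> x) r = set B))" for \<omega>
  proof
    assume a: "x \<in> tree_labels \<omega> \<and> rball_iso r (labels.tree \<omega> x) S"
    then obtain B where "rball (labels.tree \<omega> x) r = set B"
      using finite_rball[OF labels.rayed_tree_tree] finite_list by metis
    with a Q show "\<exists>B. Q (set B) \<and> (x \<in> tree_labels \<omega> \<and> rball (labels.tree \<omega> x) r = set B)" by auto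
  qed (use Q in auto)
  then have eq: "(\<lambda>\<omega>. x \<in> tree_labels \<omega> \<and> rball_iso r (labels.tree \<omega> x) S) =
    (\<lambda>\<omega>. \<exists>B. Q (set B) \<and> (x \<in> tree_labels \<omega> \<and> rball (labels.tree \<omega> x) r = set B))" by (rule ext)
  show ?thesis unfolding eq using pred_rball_eq[measurable] by measurable
qed

lemma measurable_view_fixed: "(\<lambda>\<omega>. view (\<omega>, v)) \<in> offspring_space \<rightarrow>\<^sub>M tree_space"
  unfolding tree_space_def
proof (rule measurable_measure_of)
  show "{iso_class ` {T. rayed_tree T \<and> rball_iso r T S} | r (S :: label rtree). rayed_tree S}
    \<subseteq> Pow (iso_class ` {T. rayed_tree T})" by auto
  have rayed: "rayed_tree (labels.tree \<omega> (if v \<in> tree_labels \<omega> then v else (0, [])))" for \<omega>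
    by (rule labels.rayed_tree_tree) simp
  show "(\<lambda>\<omega>. view (\<omega>, v)) \<in> space offspring_space \<rightarrow> iso_class ` {T. rayed_tree T}"
    using rayed by (auto simp: view_eq)
  fix A assume "A \<in> {iso_class ` {T. rayed_tree T \<and> rball_iso r T S} | r (S :: label rtree). rayed_tree S}"
  then obtain r and S :: "label rtree" where A: "A = iso_class ` {T. rayed_tree T \<and> rball_iso r T S}" by blast
  \<comment> \<open>Isomorphic trees have isomorphic balls, so membership of a class in
    \<open>A\<close> can be tested on any representative, in particular on the shifted tree.\<close>
  have iff: "iso_class P \<in> A \<longleftrightarrow> rball_iso r P S" if "rayed_tree P" for P
  proof
    assume "iso_class P \<in> A"
    then obtain T where T: "rayed_tree T" "rball_iso r T S" "iso_class P = iso_class T"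
      unfolding A by blast
    then have "T \<in> iso_class P" by (simp add: iso_class_def rt_iso_refl)
    then have "rt_iso P T" by (simp add: iso_class_def)
    from rt_iso_imp_rball_iso[OF this that T(1)] T(2) show "rball_iso r P S"
      by (rule rball_iso_trans)
  next
    assume "rball_iso r P S"
    with that show "iso_class P \<in> A" by (auto simp: A)
  qed
  have "(\<lambda>\<omega>. view (\<omega>, v)) -` A \<inter> space offspring_space = {\<omega> \<in> space offspring_space.
    (v \<in> tree_labels \<omega> \<and> rball_iso r (labels.tree \<omega> v) S) \<or>
    (v \<notin> tree_labels \<omega> \<and> ((0, []) \<in> tree_labels \<omega> \<and> rball_iso r (labels.tree \<omega> (0, [])) S))}"
  proof (intro set_eqI)
    fix \<omega>
    have "view (\<omega>, v) \<in> A \<longleftrightarrow> rball_iso r (labels.tree \<omega> (if v \<in> tree_labels \<omega> then v else (0, []))) S"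
      unfolding view_eq by (rule iff[OF rayed])
    then show "\<omega> \<in> (\<lambda>\<omega>. view (\<omega>, v)) -` A \<inter> space offspring_space \<longleftrightarrow> \<omega> \<in> {\<omega> \<in> space offspring_space.
    (v \<in> tree_labels \<omega> \<and> rball_iso r (labels.tree \<omega> v) S) \<or>
    (v \<notin> tree_labels \<omega> \<and> ((0, []) \<in> tree_labels \<omega> \<and> rball_iso r (labels.tree \<omega> (0, [])) S))}"
      by (cases "v \<in> tree_labels \<omega>") (simp_all add: conj_commute)
  qed
  also have "\<dots> \<in> sets offspring_space"
    using pred_rball_iso[measurable] by measurable
  finally show "(\<lambda>\<omega>. view (\<omega>, v)) -` A \<inter> space offspring_space \<in> sets offspring_space" .
qed

text \<open>The position ranges over a countable set, so each position can be fixed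
  separately.\<close>

lemma measurable_state_spaceI:
  assumes "\<And>v. (\<lambda>\<omega>. f (\<omega>, v)) \<in> offspring_space \<rightarrow>\<^sub>M N"
  shows "f \<in> state_space \<rightarrow>\<^sub>M N"
  unfolding state_space_def
  by (rule measurable_compose_countable'[where f = "\<lambda>v s. f (fst s, v)" and g = snd and I = UNIV, simplified])
     (auto intro: measurable_compose[OF measurable_fst assms])

lemma measurable_state_spaceD:
  assumes "f \<in> state_space \<rightarrow>\<^sub>M N"
  shows "(\<lambda>\<omega>. f (\<omega>, v)) \<in> offspring_space \<rightarrow>\<^sub>M N"
  using assms unfolding state_space_def by measurable

lemma measurable_view [measurable]: "view \<in> state_space \<rightarrow>\<^sub>M tree_space"
  by (rule measurable_state_spaceI) (rule measurable_view_fixed)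

lemma measurable_pmf_step:
  assumes "0 < lam"
  shows "(\<lambda>\<omega>. pmf (step lam (tree_of \<omega>) v) w) \<in> borel_measurable offspring_space"
proof (cases v)
  case (Pair n ks)
  \<comment> \<open>The value of \<open>parent\<close> at a label outside the tree: it is in no
    offspring set, so the description is empty. The step from such a label goes to \<open>c\<close>
    with probability 1.\<close>
  define c :: label where "c = (THE v. False)"
  define d where "d \<omega> = (if ks = [] \<and> n \<noteq> 0 then Suc (off_ray_children \<omega> v) else off_ray_children \<omega> v)" for \<omega>
  have d: "card (labels.children \<omega> v) = d \<omega>" if "v \<in> tree_labels \<omega>" for \<omega>
  proof -
    have inj: "inj_on (\<lambda>i. (n, ks @ [i])) A" for A :: "nat set" by (auto simp: inj_on_def)
    show ?thesis using that unfolding Pair d_def tree_labels_children[OF that[unfolded Pair]]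
      by (subst card_Un_disjoint) (auto simp: card_image[OF inj] simp del: off_ray_children.simps)
  qed
  have "pmf (step lam (tree_of \<omega>) v) w = (if v \<in> tree_labels \<omega> then
      (if w = par_label v then lam / (lam + real (d \<omega>))
       else if w \<in> tree_labels \<omega> \<and> par_label w = v then 1 / (lam + real (d \<omega>)) else 0)
      else if w = c then 1 else 0)" for \<omega>
  proof (cases "v \<in> tree_labels \<omega>")
    case True
    then show ?thesis using assms
      by (simp add: tree_of_eq labels.pmf_step labels.parent_tree_par labels.offspring_tree outdeg_def d)
  next
    case False
    have off: "offspring (tree_of \<omega>) v = {}" using False by (simp add: tree_of_eq labels.offspring_outside)
    have "v \<notin> offspring (tree_of \<omega>) u" for u using False by (auto simp: offspring_def tree_of_eq)
    then have "parent (tree_of \<omega>) v = c" by (simp add: parent_def c_def)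
    with off False show ?thesis using assms
      by (simp add: tree_of_eq labels.pmf_step outdeg_def)
  qed
  then have eq: "(\<lambda>\<omega>. pmf (step lam (tree_of \<omega>) v) w) = (\<lambda>\<omega>. if v \<in> tree_labels \<omega> then
      (if w = par_label v then lam / (lam + real (d \<omega>))
       else if w \<in> tree_labels \<omega> \<and> par_label w = v then 1 / (lam + real (d \<omega>)) else 0)
      else if w = c then 1 else 0)" by (rule ext)
  have [measurable]: "d \<in> offspring_space \<rightarrow>\<^sub>M count_space UNIV"
    unfolding d_def
    by (rule measurable_compose[OF measurable_off_ray_children[of v],
          of "\<lambda>k. if ks = [] \<and> n \<noteq> 0 then Suc k else k"]) simp
  have [measurable]: "(\<lambda>\<omega>. real (d \<omega>)) \<in> borel_measurable offspring_space"
    by (rule measurable_compose[where g = real and N = "count_space UNIV"]) measurable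
  show ?thesis unfolding eq by measurable
qed

text \<open>As an integral over the counting measure, the operator has \<omega> only in the
  integrand, where the measurability of the single transition probabilities suffices.\<close>

lemma measurable_walk_op:
  assumes "0 < lam" and F[measurable]: "F \<in> borel_measurable state_space"
  shows "walk_op lam F \<in> borel_measurable state_space"
proof (rule measurable_state_spaceI)
  fix v
  interpret sigma_finite_measure "count_space (UNIV :: label set)"
    by (rule sigma_finite_measure_count_space)
  have "(\<lambda>s. ennreal (pmf (step lam (tree_of (fst s)) v) (snd s)) * F s) \<in> borel_measurable state_space"
  proof (rule measurable_state_spaceI)
    fix w
    show "(\<lambda>\<omega>. ennreal (pmf (step lam (tree_of (fst (\<omega>, w))) v) (snd (\<omega>, w))) * F (\<omega>, w))
      \<in> borel_measurable offspring_space"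
      using measurable_pmf_step[OF assms(1), measurable] measurable_state_spaceD[OF F, measurable]
      by simp
  qed
  then have "(\<lambda>(\<omega>, w). ennreal (pmf (step lam (tree_of \<omega>) v) w) * F (\<omega>, w))
    \<in> borel_measurable (offspring_space \<Otimes>\<^sub>M count_space UNIV)"
    by (simp add: state_space_def split_def)
  from borel_measurable_nn_integral[OF this]
  show "(\<lambda>\<omega>. walk_op lam F (\<omega>, v)) \<in> borel_measurable offspring_space"
    by (simp add: walk_op_def nn_integral_measure_pmf)
qed

section \<open>Self-adjointness of the walk operator\<close>

lemma nn_integral_PiM_split:
  assumes M: "\<And>i. prob_space (M i)" and H: "H \<in> borel_measurable (Pi\<^sub>M UNIV M)"
  shows "(\<integral>\<^sup>+\<omega>. H \<omega> \<partial>Pi\<^sub>M UNIV M) = (\<integral>\<^sup>+X. \<integral>\<^sup>+x. H (X(a := x)) \<partial>M a \<partial>Pi\<^sub>M (UNIV - {a}) M)"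
proof -
  let ?I = "UNIV - {a}"
  interpret Ma: prob_space "M a" by (rule M)
  interpret MI: prob_space "Pi\<^sub>M ?I M" by (intro prob_space_PiM M)
  interpret pair_sigma_finite "M a" "Pi\<^sub>M ?I M" ..
  have UN: "insert a ?I = UNIV" by auto
  have m: "(\<lambda>(x, X). X(a := x)) \<in> M a \<Otimes>\<^sub>M Pi\<^sub>M ?I M \<rightarrow>\<^sub>M Pi\<^sub>M UNIV M"
    unfolding split_def by (rule measurable_fun_upd[where J = ?I]) (auto simp: UN)
  have "(\<integral>\<^sup>+\<omega>. H \<omega> \<partial>Pi\<^sub>M UNIV M) =
      (\<integral>\<^sup>+\<omega>. H \<omega> \<partial>distr (M a \<Otimes>\<^sub>M Pi\<^sub>M ?I M) (Pi\<^sub>M UNIV M) (\<lambda>(x, X). X(a := x)))"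
    using distr_pair_PiM_eq_PiM[of ?I M a] M by (simp add: UN)
  also have "\<dots> = (\<integral>\<^sup>+(x, X). H (X(a := x)) \<partial>(M a \<Otimes>\<^sub>M Pi\<^sub>M ?I M))"
    by (subst nn_integral_distr[OF m]) (simp_all add: H split_def)
  also have "\<dots> = (\<integral>\<^sup>+X. \<integral>\<^sup>+x. H (X(a := x)) \<partial>M a \<partial>Pi\<^sub>M ?I M)"
    using nn_integral_snd[of "\<lambda>(x, X). H (X(a := x))"] measurable_compose[OF m H]
    by (simp add: split_def)
  finally show ?thesis .
qed

lemma sets_PiM_pmf: "sets (\<Pi>\<^sub>M v\<in>UNIV. measure_pmf (law v)) = sets (\<Pi>\<^sub>M v\<in>UNIV. count_space UNIV)"
  by (rule sets_PiM_cong) auto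

lemma measurable_PiM_pmf:
  "measurable (\<Pi>\<^sub>M v\<in>UNIV. measure_pmf (law v)) N = measurable (\<Pi>\<^sub>M v\<in>UNIV. count_space UNIV) N"
  by (rule measurable_cong_sets) (simp_all add: sets_PiM_pmf)

text \<open>Fubini isolates the coordinate \<open>a\<close>, where the laws differ by the density
  \<open>f\<close>; the remaining coordinates have the same product law.\<close>

lemma nn_integral_PiM_pmf_change:
  fixes law law' :: "'i \<Rightarrow> 'a pmf" and f :: "'a \<Rightarrow> ennreal"
  assumes off: "\<And>v. v \<noteq> a \<Longrightarrow> law v = law' v"
    and on: "\<And>k. ennreal (pmf (law a) k) = f k * ennreal (pmf (law' a) k)"
    and H: "H \<in> borel_measurable (\<Pi>\<^sub>M v\<in>UNIV. count_space UNIV)"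
  shows "(\<integral>\<^sup>+\<omega>. H \<omega> \<partial>(\<Pi>\<^sub>M v\<in>UNIV. measure_pmf (law v))) =
    (\<integral>\<^sup>+\<omega>. f (\<omega> a) * H \<omega> \<partial>(\<Pi>\<^sub>M v\<in>UNIV. measure_pmf (law' v)))"
proof -
  have inner: "(\<integral>\<^sup>+x. h x \<partial>measure_pmf (law a)) = (\<integral>\<^sup>+x. f x * h x \<partial>measure_pmf (law' a))" for h
    unfolding nn_integral_measure_pmf by (simp add: on ac_simps)
  have cong: "Pi\<^sub>M (UNIV - {a}) (\<lambda>v. measure_pmf (law v)) = Pi\<^sub>M (UNIV - {a}) (\<lambda>v. measure_pmf (law' v))"
    by (rule PiM_cong) (auto simp: off)
  have "(\<lambda>\<omega>. \<omega> a) \<in> (\<Pi>\<^sub>M v\<in>UNIV. count_space UNIV) \<rightarrow>\<^sub>M count_space UNIV"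
    by (rule measurable_component_singleton) simp
  from measurable_compose[OF this, of f borel]
  have fH: "(\<lambda>\<omega>. f (\<omega> a) * H \<omega>) \<in> borel_measurable (\<Pi>\<^sub>M v\<in>UNIV. count_space UNIV)"
    using H by (intro borel_measurable_times_ennreal) auto
  show ?thesis
    using H fH
    by (subst (1 2) nn_integral_PiM_split[where a = a])
       (simp_all add: measurable_PiM_pmf prob_space_measure_pmf cong inner)
qed

text \<open>The law \<open>Q\<close> of the overview.\<close>

definition root_moved :: "nat pmf \<Rightarrow> label \<Rightarrow> nat pmf" where
  "root_moved p = (offspring_law p)((0, []) := p)"

text \<open>The law seen from a child of the root under \<open>root_moved\<close>: the old root
  becomes \<open>(Suc 0, [])\<close> and keeps the law \<open>p\<close>, although it is now a ray
  vertex.\<close>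

definition two_moved :: "nat pmf \<Rightarrow> label \<Rightarrow> nat pmf" where
  "two_moved p = (root_moved p)((Suc 0, []) := p)"

abbreviation pmf_product :: "(label \<Rightarrow> nat pmf) \<Rightarrow> (label \<Rightarrow> nat) measure" where
  "pmf_product law \<equiv> \<Pi>\<^sub>M v\<in>UNIV. measure_pmf (law v)"

lemma nn_integral_mean:
  assumes "mean p > 1"
  shows "(\<integral>\<^sup>+k. ennreal (real k * pmf p k) \<partial>count_space UNIV) = ennreal (mean p)"
proof -
  \<comment> \<open>The integral of a function that is not integrable is 0 by convention, so
    \<open>mean p > 1\<close> already gives integrability.\<close>
  have "integrable (measure_pmf p) real"
    using assms not_integrable_integral_eq[of "measure_pmf p" real] unfolding mean_def by force
  then have "(\<integral>\<^sup>+k. ennreal (real k) \<partial>measure_pmf p) = ennreal (mean p)"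
    unfolding mean_def by (rule nn_integral_eq_integral) simp
  then show ?thesis
    by (simp add: nn_integral_measure_pmf ennreal_mult' mult.commute)
qed

lemma nn_integral_pmf_1: "(\<integral>\<^sup>+k. ennreal (pmf p k) \<partial>count_space UNIV) = 1"
  using nn_integral_measure_pmf[of p "\<lambda>_. 1"] by simp

lemma pmf_size_biased:
  assumes "mean p > 1"
  shows "pmf (offspring_law p (Suc n, [])) k = real k * pmf p k / mean p"
proof -
  have "(\<integral>\<^sup>+k. ennreal (real k * pmf p k / mean p) \<partial>count_space UNIV) =
      (\<integral>\<^sup>+k. ennreal (1 / mean p) * ennreal (real k * pmf p k) \<partial>count_space UNIV)"
    using assms by (intro nn_integral_cong) (simp add: ennreal_mult'[symmetric])
  also have "\<dots> = ennreal (1 / mean p) * ennreal (mean p)"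
    by (simp add: nn_integral_cmult nn_integral_mean[OF assms])
  also have "\<dots> = 1" using assms by (simp add: ennreal_mult'[symmetric])
  finally show ?thesis using assms by (simp add: pmf_embed_pmf)
qed

text \<open>The root law is the equal mixture of \<open>p\<close> and its size-biased version, which
  gives the total mass 1.\<close>

lemma pmf_root_law:
  assumes "mean p > 1"
  shows "pmf (offspring_law p (0, [])) k = (mean p + real k) * pmf p k / (2 * mean p)"
proof -
  have "(\<integral>\<^sup>+k. ennreal ((mean p + real k) * pmf p k / (2 * mean p)) \<partial>count_space UNIV) =
      (\<integral>\<^sup>+k. ennreal (1 / 2) * ennreal (pmf p k) +
        ennreal (1 / (2 * mean p)) * ennreal (real k * pmf p k) \<partial>count_space UNIV)"
  proof (rule nn_integral_cong)
    fix k
    have "(mean p + real k) * pmf p k / (2 * mean p) =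
        1 / 2 * pmf p k + 1 / (2 * mean p) * (real k * pmf p k)"
      using assms by (simp add: field_simps)
    moreover have "ennreal (1 / 2) * ennreal (pmf p k) = ennreal (1 / 2 * pmf p k)"
      by (rule ennreal_mult'[symmetric]) simp
    moreover have "ennreal (1 / (2 * mean p)) * ennreal (real k * pmf p k) =
        ennreal (1 / (2 * mean p) * (real k * pmf p k))"
      by (rule ennreal_mult'[symmetric]) (use assms in simp)
    moreover have "ennreal (1 / 2 * pmf p k + 1 / (2 * mean p) * (real k * pmf p k)) =
        ennreal (1 / 2 * pmf p k) + ennreal (1 / (2 * mean p) * (real k * pmf p k))"
      by (rule ennreal_plus) (use assms in simp_all)
    ultimately show "ennreal ((mean p + real k) * pmf p k / (2 * mean p)) =
        ennreal (1 / 2) * ennreal (pmf p k) + ennreal (1 / (2 * mean p)) * ennreal (real k * pmf p k)"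
      by presburger
  qed
  also have "\<dots> = ennreal (1 / 2) * 1 + ennreal (1 / (2 * mean p)) * ennreal (mean p)"
    by (simp add: nn_integral_add nn_integral_cmult nn_integral_mean[OF assms] nn_integral_pmf_1)
  also have "\<dots> = ennreal (1 / 2) + ennreal (1 / 2)"
    using assms by (simp add: ennreal_mult'[symmetric])
  also have "\<dots> = ennreal (1 / 2 + 1 / 2)" by (rule ennreal_plus[symmetric]) simp_all
  also have "\<dots> = 1" by simp
  finally show ?thesis using assms by (simp add: pmf_embed_pmf)
qed

lemma nn_integral_offspring_numbers:
  assumes "mean p > 1" "H \<in> borel_measurable offspring_space"
  shows "(\<integral>\<^sup>+\<omega>. H \<omega> \<partial>offspring_numbers p) =
    (\<integral>\<^sup>+\<omega>. ennreal ((mean p + real (\<omega> (0, []))) / (2 * mean p)) * H \<omega> \<partial>pmf_product (root_moved p))"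
  unfolding offspring_numbers_def
proof (rule nn_integral_PiM_pmf_change)
  show "ennreal (pmf (offspring_law p (0, [])) k) =
    ennreal ((mean p + real k) / (2 * mean p)) * ennreal (pmf (root_moved p (0, [])) k)" for k
    using assms(1) unfolding pmf_root_law[OF assms(1)] root_moved_def
    by (simp add: ennreal_mult'[symmetric])
qed (use assms in \<open>auto simp: root_moved_def\<close>)

text \<open>The first ray vertex plays the part of the old root in the picture seen from a child.
  Replacing its size-biased law by \<open>p\<close> at the price of the density \<open>k / m\<close>
  makes the two pictures comparable.\<close>

lemma nn_integral_root_moved:
  assumes "mean p > 1" "H \<in> borel_measurable offspring_space"
  shows "(\<integral>\<^sup>+\<omega>. H \<omega> \<partial>pmf_product (root_moved p)) =
    (\<integral>\<^sup>+\<omega>. ennreal (real (\<omega> (Suc 0, [])) / mean p) * H \<omega> \<partial>pmf_product (two_moved p))"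
proof (rule nn_integral_PiM_pmf_change)
  have [simp]: "root_moved p (Suc 0, []) = offspring_law p (Suc 0, [])"
    unfolding root_moved_def by (simp del: offspring_law.simps)
  show "ennreal (pmf (root_moved p (Suc 0, [])) k) =
    ennreal (real k / mean p) * ennreal (pmf (two_moved p (Suc 0, [])) k)" for k
    using assms(1) by (simp add: two_moved_def pmf_size_biased ennreal_mult'[symmetric] del: offspring_law.simps)
qed (use assms in \<open>auto simp: two_moved_def\<close>)

section \<open>Relabelling from a child of the root\<close>

text \<open>Translates labels of the tree seen from the child \<open>(0, [i])\<close> of the root into the original
  labels: \<open>(1, [])\<close> is the old root, whose remaining children are renumbered to skip \<open>i\<close>.\<close>

fun descend :: "nat \<Rightarrow> label \<Rightarrow> label" where
  "descend i (0, ks) = (0, i # ks)"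
| "descend i (Suc 0, []) = (0, [])"
| "descend i (Suc 0, j # ks) = (0, (if j < i then j else Suc j) # ks)"
| "descend i (Suc (Suc n), ks) = (Suc n, ks)"

lemma inj_descend: "inj (descend i)"
proof (rule injI)
  fix u v assume "descend i u = descend i v"
  then show "u = v"
    by (cases "(i, u)" rule: descend.cases; cases "(i, v)" rule: descend.cases) (auto split: if_splits)
qed

lemma surj_descend: "surj (descend i)"
proof (rule surjI)
  define g :: "label \<Rightarrow> label" where "g = (\<lambda>(n, ks). if n = 0
    then (case ks of [] \<Rightarrow> (Suc 0, []) | j # js \<Rightarrow>
      if j = i then (0, js) else (Suc 0, (if j < i then j else j - 1) # js))
    else (Suc n, ks))"
  show "descend i (g v) = v" for v
    by (cases v; cases "fst v"; cases "snd v") (auto simp: g_def)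
qed

text \<open>Only the children of the old root are renumbered; at every other vertex
  \<open>descend\<close> commutes with appending a child index.\<close>

lemma descend_snoc:
  "descend i (n, ks @ [k]) = (fst (descend i (n, ks)), snd (descend i (n, ks)) @
    [if n = Suc 0 \<and> ks = [] \<and> i \<le> k then Suc k else k])"
  by (cases "(i, (n, ks))" rule: descend.cases) auto

lemma par_label_descend: "par_label (descend i v) = descend i (par_label v)"
proof (cases v)
  case (Pair n ks)
  show ?thesis
  proof (cases ks rule: rev_cases)
    case Nil
    then show ?thesis unfolding Pair by (cases "(i, (n, ks))" rule: descend.cases) auto
  next
    case (snoc js k)
    then show ?thesis unfolding Pair snoc descend_snoc by simp
  qed
qed

text \<open>The old root is the only vertex whose role changes: in the original labels all its
  offspring are off the ray, while from the child \<open>i\<close> it is a ray vertex, and that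
  child is on the ray.\<close>

lemma off_ray_children_descend:
  "off_ray_children (\<lambda>l. \<omega> (descend i l)) v =
    (if v = (Suc 0, []) then \<omega> (0, []) - 1 else off_ray_children \<omega> (descend i v))"
  by (cases "(i, v)" rule: descend.cases) auto

lemma descend_in_tree_labels:
  assumes "i < \<omega> (0, [])"
  shows "v \<in> tree_labels (\<lambda>l. \<omega> (descend i l)) \<longleftrightarrow> descend i v \<in> tree_labels \<omega>"
proof -
  have "(n, ks) \<in> tree_labels (\<lambda>l. \<omega> (descend i l)) \<longleftrightarrow> descend i (n, ks) \<in> tree_labels \<omega>" for n ks
  proof (induction ks rule: rev_induct)
    case Nil
    have "(0, [] @ [i]) \<in> tree_labels \<omega>" unfolding snoc_in_tree_labels using assms by simp
    then show ?case by (cases "(i, (n, [] :: nat list))" rule: descend.cases) auto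
  next
    case (snoc k ks)
    \<comment> \<open>At the old root, \<open>i < \<omega> (0, [])\<close> makes the subtraction in
      \<open>\<omega> (0, []) - 1\<close> exact: an index below \<open>i\<close> is valid on both
      sides, and the others move up by one.\<close>
    have "(if n = Suc 0 \<and> ks = [] \<and> i \<le> k then Suc k else k) < off_ray_children \<omega> (descend i (n, ks)) \<longleftrightarrow>
      k < off_ray_children (\<lambda>l. \<omega> (descend i l)) (n, ks)"
      unfolding off_ray_children_descend using assms by auto
    then show ?case
      unfolding descend_snoc snoc_in_tree_labels prod.collapse snoc.IH by simp
  qed
  then show ?thesis by (cases v) simp
qed

lemma same_view_descend:
  assumes "i < \<omega> (0, [])" "v \<in> tree_labels (\<lambda>l. \<omega> (descend i l))"
  shows "same_view ((\<lambda>l. \<omega> (descend i l)), v) (\<omega>, descend i v)"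
proof -
  have "bij_betw (descend i) (tree_labels (\<lambda>l. \<omega> (descend i l))) (tree_labels \<omega>)"
    unfolding bij_betw_def
  proof
    show "inj_on (descend i) (tree_labels (\<lambda>l. \<omega> (descend i l)))"
      using inj_descend by (rule inj_on_subset) simp
    show "descend i ` tree_labels (\<lambda>l. \<omega> (descend i l)) = tree_labels \<omega>"
    proof (intro equalityI subsetI)
      fix u assume u: "u \<in> tree_labels \<omega>"
      obtain w where "u = descend i w" using surj_descend by (rule surjE)
      with u show "u \<in> descend i ` tree_labels (\<lambda>l. \<omega> (descend i l))"
        using descend_in_tree_labels[of i \<omega>] assms(1) by blast
    qed (use descend_in_tree_labels[of i \<omega>] assms(1) in blast)
  qed
  with assms(2) show ?thesis
    unfolding same_view_def prod.case by (metis par_label_descend)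
qed

text \<open>The new root was off the ray and the old root had its law reset, so both have law
  \<open>p\<close>. The later ray vertices only change their index, on which the size-biased law
  does not depend.\<close>

lemma two_moved_descend: "root_moved p (descend i v) = two_moved p v"
  by (cases "(i, v)" rule: descend.cases) (auto simp: two_moved_def root_moved_def)

lemma distr_descend:
  "distr (pmf_product (root_moved p)) (pmf_product (two_moved p)) (\<lambda>\<omega> l. \<omega> (descend i l)) =
    pmf_product (two_moved p)"
  using distr_PiM_reindex[of UNIV "\<lambda>v. measure_pmf (root_moved p v)" "descend i" UNIV] inj_descend[of i]
  by (simp add: two_moved_descend prob_space_measure_pmf restrict_def)

lemma suminf_if_less_ennreal: "(\<Sum>i. if i < k then h i else 0) = (\<Sum>i<k. h i :: ennreal)"
  by (subst suminf_finite[of "{..<k}"]) auto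

text \<open>Seen from the child \<open>i\<close>, the offspring numbers have the law \<open>two_moved p\<close>, which does not
  depend on \<open>i\<close>. Summing over the \<open>k\<close> children of the old root therefore produces a factor \<open>k\<close>,
  which is \<open>mean p\<close> times the density of the size-biased law of the first ray vertex.\<close>

lemma nn_integral_children:
  assumes m: "mean p > 1"
    and F: "F \<in> borel_measurable state_space" "view_invariant F"
    and G: "G \<in> borel_measurable state_space" "view_invariant G"
  shows "(\<integral>\<^sup>+\<omega>. (\<Sum>i<\<omega> (0, []). F (\<omega>, (0, [])) * G (\<omega>, (0, [i]))) \<partial>pmf_product (root_moved p)) =
    ennreal (mean p) * (\<integral>\<^sup>+\<omega>. G (\<omega>, (0, [])) * F (\<omega>, (Suc 0, [])) \<partial>pmf_product (root_moved p))"
proof -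
  let ?Q = "pmf_product (root_moved p)" and ?R = "pmf_product (two_moved p)"
  note [measurable] = measurable_state_spaceD[OF F(1)] measurable_state_spaceD[OF G(1)]
  note [simp] = measurable_PiM_pmf
  define H where "H \<omega> = G (\<omega>, (0, [])) * F (\<omega>, (Suc 0, []))" for \<omega>
  have H[measurable]: "H \<in> borel_measurable offspring_space" unfolding H_def by measurable
  have FG: "F (\<omega>, (0, [])) * G (\<omega>, (0, [i])) = H (\<lambda>l. \<omega> (descend i l))" if i: "i < \<omega> (0, [])" for \<omega> i
  proof -
    have "F (\<omega>, (0, [])) = F (\<lambda>l. \<omega> (descend i l), (Suc 0, []))"
      using F(2) same_view_descend[of i \<omega> "(Suc 0, [])"] i unfolding view_invariant_def by force
    moreover have "G (\<omega>, (0, [i])) = G (\<lambda>l. \<omega> (descend i l), (0, []))"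
      using G(2) same_view_descend[of i \<omega> "(0, [])"] i unfolding view_invariant_def by force
    ultimately show ?thesis by (simp add: H_def mult.commute)
  qed
  have "(\<integral>\<^sup>+\<omega>. (\<Sum>i<\<omega> (0, []). F (\<omega>, (0, [])) * G (\<omega>, (0, [i]))) \<partial>?Q) =
      (\<integral>\<^sup>+\<omega>. (\<Sum>i. if i < \<omega> (0, []) then F (\<omega>, (0, [])) * G (\<omega>, (0, [i])) else 0) \<partial>?Q)"
    by (simp only: suminf_if_less_ennreal)
  \<comment> \<open>The number of children is random. As a series with a cut-off, the sum can be
    exchanged with the integral, and each \<open>i\<close> is then relabelled separately.\<close>
  also have "\<dots> = (\<Sum>i. \<integral>\<^sup>+\<omega>. (if i < \<omega> (0, []) then F (\<omega>, (0, [])) * G (\<omega>, (0, [i])) else 0) \<partial>?Q)"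
    by (rule nn_integral_suminf) simp
  also have "\<dots> = (\<Sum>i. \<integral>\<^sup>+\<omega>. (if i < \<omega> (Suc 0, []) then H \<omega> else 0) \<partial>?R)"
  proof (rule suminf_cong)
    fix i
    have desc: "(\<lambda>\<omega> l. \<omega> (descend i l)) \<in> ?Q \<rightarrow>\<^sub>M ?R"
      by (rule measurable_PiM_single') (auto simp: space_PiM)
    have "(\<integral>\<^sup>+\<omega>. (if i < \<omega> (0, []) then F (\<omega>, (0, [])) * G (\<omega>, (0, [i])) else 0) \<partial>?Q) =
      (\<integral>\<^sup>+\<omega>. (if i < \<omega> (descend i (Suc 0, [])) then H (\<lambda>l. \<omega> (descend i l)) else 0) \<partial>?Q)"
      by (rule nn_integral_cong) (simp add: FG)
    also have "\<dots> = (\<integral>\<^sup>+\<omega>. (if i < \<omega> (Suc 0, []) then H \<omega> else 0) \<partial>distr ?Q ?R (\<lambda>\<omega> l. \<omega> (descend i l)))"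
      by (rule nn_integral_distr[OF desc, symmetric]) simp
    finally show "(\<integral>\<^sup>+\<omega>. (if i < \<omega> (0, []) then F (\<omega>, (0, [])) * G (\<omega>, (0, [i])) else 0) \<partial>?Q) =
      (\<integral>\<^sup>+\<omega>. (if i < \<omega> (Suc 0, []) then H \<omega> else 0) \<partial>?R)"
      unfolding distr_descend .
  qed
  also have "\<dots> = (\<integral>\<^sup>+\<omega>. (\<Sum>i. if i < \<omega> (Suc 0, []) then H \<omega> else 0) \<partial>?R)"
    by (rule nn_integral_suminf[symmetric]) simp
  also have "\<dots> = (\<integral>\<^sup>+\<omega>. ennreal (mean p) * (ennreal (real (\<omega> (Suc 0, [])) / mean p) * H \<omega>) \<partial>?R)"
    unfolding suminf_if_less_ennreal using m
    by (intro nn_integral_cong)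
       (simp add: mult.assoc[symmetric] ennreal_mult'[symmetric] ennreal_of_nat_eq_real_of_nat)
  also have "\<dots> = ennreal (mean p) * (\<integral>\<^sup>+\<omega>. H \<omega> \<partial>?Q)"
    unfolding nn_integral_root_moved[OF m H] by (rule nn_integral_cmult) simp
  finally show ?thesis by (simp add: H_def)
qed

lemma children_root: "labels.children \<omega> (0, []) = (\<lambda>i. (0, [i])) ` {..<\<omega> (0, [])}"
  using tree_labels_children[of 0 "[]" \<omega>] by simp

lemma walk_op_root:
  assumes "0 < lam"
  shows "walk_op lam G (\<omega>, (0, [])) =
    ennreal (lam / (lam + real (\<omega> (0, [])))) * G (\<omega>, (Suc 0, [])) +
    ennreal (1 / (lam + real (\<omega> (0, [])))) * (\<Sum>i<\<omega> (0, []). G (\<omega>, (0, [i])))"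
proof -
  have inj: "inj_on (\<lambda>i. (0, [i])) A" for A :: "nat set" by (simp add: inj_on_def)
  show ?thesis
    using assms by (simp add: walk_op_eq children_root card_image[OF inj] sum.reindex[OF inj] sum_distrib_left)
qed

lemma nn_integral_walk_op_root:
  assumes m: "mean p > 1"
    and F: "F \<in> borel_measurable state_space" "view_invariant F"
    and G: "G \<in> borel_measurable state_space" "view_invariant G"
  shows "(\<integral>\<^sup>+\<omega>. F (\<omega>, (0, [])) * walk_op (mean p) G (\<omega>, (0, [])) \<partial>offspring_numbers p) =
    ennreal (1 / 2) * ((\<integral>\<^sup>+\<omega>. F (\<omega>, (0, [])) * G (\<omega>, (Suc 0, [])) \<partial>pmf_product (root_moved p)) +
      (\<integral>\<^sup>+\<omega>. G (\<omega>, (0, [])) * F (\<omega>, (Suc 0, [])) \<partial>pmf_product (root_moved p)))"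
proof -
  let ?Q = "pmf_product (root_moved p)" and ?m = "mean p"
  have m0: "0 < ?m" using m by simp
  note [measurable] = measurable_state_spaceD[OF F(1)] measurable_state_spaceD[OF G(1)]
    measurable_state_spaceD[OF measurable_walk_op[OF m0 G(1)]]
  note [simp] = measurable_PiM_pmf
  let ?S = "\<lambda>\<omega>. \<Sum>i<\<omega> (0, []). F (\<omega>, (0, [])) * G (\<omega>, (0, [i]))"
  have S[measurable]: "?S \<in> borel_measurable offspring_space"
    unfolding suminf_if_less_ennreal[symmetric] by measurable
  have factor: "a * (f * (b * x + c * y)) = b' * (f * x) + c' * (f * y)"
    if "a * b = b'" "a * c = c'" for a b c b' c' f x y :: ennreal
    unfolding that[symmetric] by (simp add: algebra_simps)
  have "(\<integral>\<^sup>+\<omega>. F (\<omega>, (0, [])) * walk_op ?m G (\<omega>, (0, [])) \<partial>offspring_numbers p) =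
    (\<integral>\<^sup>+\<omega>. ennreal ((?m + real (\<omega> (0, []))) / (2 * ?m)) *
      (F (\<omega>, (0, [])) * walk_op ?m G (\<omega>, (0, []))) \<partial>?Q)"
    by (rule nn_integral_offspring_numbers[OF m]) measurable
  also have "\<dots> = (\<integral>\<^sup>+\<omega>. ennreal (1 / 2) * (F (\<omega>, (0, [])) * G (\<omega>, (Suc 0, []))) +
      ennreal (1 / (2 * ?m)) * ?S \<omega> \<partial>?Q)"
  proof (rule nn_integral_cong)
    fix \<omega> :: "label \<Rightarrow> nat"
    let ?d = "real (\<omega> (0, []))" and ?g = "\<Sum>i<\<omega> (0, []). G (\<omega>, (0, [i]))"
    have pos: "?m + ?d > 0" using m0 by simp
    then have ne: "?m \<noteq> 0" "?m + ?d \<noteq> 0" using m0 by auto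
    have "(?m + ?d) / (2 * ?m) * (?m / (?m + ?d)) = 1 / 2"
      "(?m + ?d) / (2 * ?m) * (1 / (?m + ?d)) = 1 / (2 * ?m)"
      using ne by simp_all
    moreover have "(?m + ?d) / (2 * ?m) \<ge> 0" using m0 by simp
    ultimately have "ennreal ((?m + ?d) / (2 * ?m)) * ennreal (?m / (?m + ?d)) = ennreal (1 / 2)"
      "ennreal ((?m + ?d) / (2 * ?m)) * ennreal (1 / (?m + ?d)) = ennreal (1 / (2 * ?m))"
      by (metis ennreal_mult')+
    then show "ennreal ((?m + ?d) / (2 * ?m)) * (F (\<omega>, (0, [])) * walk_op ?m G (\<omega>, (0, []))) =
      ennreal (1 / 2) * (F (\<omega>, (0, [])) * G (\<omega>, (Suc 0, []))) + ennreal (1 / (2 * ?m)) * ?S \<omega>"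
      unfolding walk_op_root[OF m0] sum_distrib_left[symmetric] by (rule factor)
  qed
  also have "\<dots> = ennreal (1 / 2) * (\<integral>\<^sup>+\<omega>. F (\<omega>, (0, [])) * G (\<omega>, (Suc 0, [])) \<partial>?Q) +
      ennreal (1 / (2 * ?m)) * (\<integral>\<^sup>+\<omega>. ?S \<omega> \<partial>?Q)"
    using S by (simp add: nn_integral_add nn_integral_cmult)
  \<comment> \<open>The factor \<open>m\<close> produced by the children turns
    \<open>1 / (2 * m)\<close> into \<open>1 / 2\<close>, the weight of the parent term.\<close>
  also have "ennreal (1 / (2 * ?m)) * (\<integral>\<^sup>+\<omega>. ?S \<omega> \<partial>?Q) =
      ennreal (1 / 2) * (\<integral>\<^sup>+\<omega>. G (\<omega>, (0, [])) * F (\<omega>, (Suc 0, [])) \<partial>?Q)"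
    unfolding nn_integral_children[OF assms] mult.assoc[symmetric]
    using m0 by (simp add: ennreal_mult'[symmetric])
  finally show ?thesis by (simp only: distrib_left)
qed

lemma walk_op_self_adjoint:
  assumes "mean p > 1"
    and "F \<in> borel_measurable state_space" "view_invariant F"
    and "G \<in> borel_measurable state_space" "view_invariant G"
  shows "(\<integral>\<^sup>+\<omega>. F (\<omega>, (0, [])) * walk_op (mean p) G (\<omega>, (0, [])) \<partial>offspring_numbers p) =
    (\<integral>\<^sup>+\<omega>. G (\<omega>, (0, [])) * walk_op (mean p) F (\<omega>, (0, [])) \<partial>offspring_numbers p)"
  using assms by (simp add: nn_integral_walk_op_root add.commute)

section \<open>The joint law of the environments\<close>

lemma space_offspring_space [simp]: "space offspring_space = UNIV"
  by (simp add: space_PiM)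

lemma space_state_space [simp]: "space state_space = UNIV"
  by (simp add: state_space_def space_pair_measure)

lemma rt_root_tree_of: "rt_root (tree_of \<omega>) = (0, [])"
  by (simp add: tree_of_def)

lemma view_root: "view (\<omega>, (0, [])) = iso_class (tree_of \<omega>)"
  by (simp add: view_eq tree_of_eq)

lemma measurable_Pair_state: "Pair \<omega> \<in> measure_pmf q \<rightarrow>\<^sub>M state_space"
  by simp

lemma measurable_offspring_numbers: "measurable (offspring_numbers p) N = measurable offspring_space N"
  unfolding offspring_numbers_def by (rule measurable_PiM_pmf)

lemma measurable_start: "(\<lambda>\<omega>. (\<omega>, rt_root (tree_of \<omega>))) \<in> offspring_numbers p \<rightarrow>\<^sub>M state_space"
  unfolding measurable_offspring_numbers rt_root_tree_of state_space_def by measurable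

lemma prob_space_offspring_numbers: "prob_space (offspring_numbers p)"
  unfolding offspring_numbers_def by (intro prob_space_PiM prob_space_measure_pmf)

lemma emeasure_distr_nn_integral:
  assumes "f \<in> M \<rightarrow>\<^sub>M N" "A \<in> sets N"
  shows "emeasure (distr M N f) A = (\<integral>\<^sup>+x. indicator A (f x) \<partial>M)"
  using nn_integral_distr[OF assms(1), of "indicator A"] assms(2) by simp

definition step_kernel :: "real \<Rightarrow> (label \<Rightarrow> nat) \<times> label \<Rightarrow> ((label \<Rightarrow> nat) \<times> label) measure" where
  "step_kernel lam = (\<lambda>(\<omega>, v). distr (measure_pmf (step lam (tree_of \<omega>) v)) state_space (Pair \<omega>))"

lemma sets_step_kernel [simp]: "sets (step_kernel lam s) = sets state_space"
  by (simp add: step_kernel_def split_def)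

lemma prob_space_step_kernel: "prob_space (step_kernel lam s)"
  unfolding step_kernel_def split_def
  by (intro prob_space.prob_space_distr prob_space_measure_pmf measurable_Pair_state)

lemma nn_integral_step_kernel:
  assumes "F \<in> borel_measurable state_space"
  shows "(\<integral>\<^sup>+s'. F s' \<partial>step_kernel lam s) = walk_op lam F s"
  unfolding step_kernel_def walk_op_def split_def
  by (subst nn_integral_distr[OF measurable_Pair_state]) (simp_all add: assms)

lemma measurable_step_kernel:
  assumes "0 < lam"
  shows "step_kernel lam \<in> state_space \<rightarrow>\<^sub>M subprob_algebra state_space"
proof (rule measurable_subprob_algebra)
  show "subprob_space (step_kernel lam s)" for s
    using prob_space_step_kernel by (rule prob_space_imp_subprob_space)
  fix A assume A: "A \<in> sets state_space"
  have "emeasure (step_kernel lam s) A = walk_op lam (indicator A) s" for s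
    using A nn_integral_step_kernel[of "indicator A" lam s] by simp
  then show "(\<lambda>s. emeasure (step_kernel lam s) A) \<in> borel_measurable state_space"
    using measurable_walk_op[OF assms, of "indicator A"] A by simp
qed simp

section \<open>Markov property of the walk measure\<close>

locale biased_walk =
  fixes p :: "nat pmf"
  assumes mean: "mean p > 1"
begin

abbreviation m :: real where "m \<equiv> mean p"

lemma m_pos: "0 < m" using mean by simp

lemma walk_kernel_Suc: "walk_kernel p m (Suc t) h = step_kernel m (h t)"
  by (simp add: step_kernel_def split_def)

sublocale IT: Ionescu_Tulcea "walk_kernel p m" "\<lambda>_. state_space"
proof (rule Ionescu_Tulcea.intro)
  have start: "prob_space (distr (offspring_numbers p) state_space (\<lambda>\<omega>. (\<omega>, rt_root (tree_of \<omega>))))"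
    by (rule prob_space.prob_space_distr[OF prob_space_offspring_numbers measurable_start])
  show "walk_kernel p m i \<in> (\<Pi>\<^sub>M j\<in>{0..<i}. state_space) \<rightarrow>\<^sub>M subprob_algebra state_space" for i
  proof (cases i)
    case 0
    have "distr (offspring_numbers p) state_space (\<lambda>\<omega>. (\<omega>, rt_root (tree_of \<omega>))) \<in> space (subprob_algebra state_space)"
      unfolding space_subprob_algebra using prob_space_imp_subprob_space[OF start] by simp
    moreover have "walk_kernel p m 0 =
        (\<lambda>_. distr (offspring_numbers p) state_space (\<lambda>\<omega>. (\<omega>, rt_root (tree_of \<omega>))))" by (rule ext) simp
    ultimately show ?thesis unfolding 0 by (simp only: measurable_const)
  next
    case (Suc t)
    have "(\<lambda>h. h t) \<in> (\<Pi>\<^sub>M j\<in>{0..<Suc t}. state_space) \<rightarrow>\<^sub>M state_space"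
      by (rule measurable_component_singleton) simp
    from measurable_compose[OF this measurable_step_kernel[OF m_pos]]
    have "(\<lambda>h. walk_kernel p m (Suc t) h) \<in> (\<Pi>\<^sub>M j\<in>{0..<Suc t}. state_space) \<rightarrow>\<^sub>M subprob_algebra state_space"
      unfolding walk_kernel_Suc .
    then show ?thesis by (simp only: Suc)
  qed
  show "prob_space (walk_kernel p m i h)" for i h
    by (cases i) (simp_all only: walk_kernel_Suc walk_kernel.simps(1) start prob_space_step_kernel)
qed

abbreviation start where "start \<equiv> (\<lambda>_::nat. undefined :: (label \<Rightarrow> nat) \<times> label)"

lemma walk_measure_eq: "walk_measure p m = IT.PF.lim"
  by (simp add: walk_measure_def)

lemma sets_walk_measure: "sets (walk_measure p m) = sets (\<Pi>\<^sub>M i\<in>UNIV. state_space)"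
  by (simp add: walk_measure_eq)

lemma measurable_walk_measure: "measurable (walk_measure p m) N = measurable (\<Pi>\<^sub>M i\<in>UNIV. state_space) N"
  by (rule measurable_cong_sets) (simp_all add: sets_walk_measure)

text \<open>Over an initial segment of times the cylinder above an event is the event itself, so the
  marginal is the plain composition of the kernels.\<close>

lemma CI_initial: "IT.CI {0..<n} = IT.C 0 n start"
proof (rule measure_eqI)
  have u: "start \<in> space (\<Pi>\<^sub>M i\<in>{0..<0}. state_space)" by (simp add: space_PiM)
  show "sets (IT.CI {0..<n}) = sets (IT.C 0 n start)"
    unfolding IT.CI_def using IT.sets_C[OF u, of n] by simp
  fix X assume "X \<in> sets (IT.CI {0..<n})"
  then have X: "X \<in> sets (\<Pi>\<^sub>M i\<in>{0..<n}. state_space)" by (simp add: IT.CI_def)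
  show "emeasure (IT.CI {0..<n}) X = emeasure (IT.C 0 n start) X"
    using IT.emeasure_CI[OF subset_refl X]
    unfolding prod_emb_id[OF sets.sets_into_space[OF X, unfolded space_PiM]] .
qed

text \<open>Products of functions of single times suffice: with indicators they give the measures of
  boxes, which determine the law of a process.\<close>

definition joint :: "nat \<Rightarrow> (nat \<Rightarrow> (label \<Rightarrow> nat) \<times> label \<Rightarrow> ennreal) \<Rightarrow> ennreal" where
  "joint n F = (\<integral>\<^sup>+h. (\<Prod>t\<le>n. F t (h t)) \<partial>walk_measure p m)"

definition at_root :: "((label \<Rightarrow> nat) \<times> label \<Rightarrow> ennreal) \<Rightarrow> ennreal" where
  "at_root F = (\<integral>\<^sup>+\<omega>. F (\<omega>, (0, [])) \<partial>offspring_numbers p)"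

lemma measurable_prod_coordinates:
  assumes "\<And>t. t \<in> J \<Longrightarrow> F t \<in> borel_measurable state_space" "J \<subseteq> I"
  shows "(\<lambda>h. \<Prod>t\<in>J. F t (h t) :: ennreal) \<in> borel_measurable (\<Pi>\<^sub>M i\<in>I. state_space)"
proof (rule borel_measurable_prod_ennreal)
  fix t assume "t \<in> J"
  with assms(2) have "(\<lambda>h. h t) \<in> (\<Pi>\<^sub>M i\<in>I. state_space) \<rightarrow>\<^sub>M state_space"
    by (intro measurable_component_singleton) auto
  from measurable_compose[OF this assms(1)[OF \<open>t \<in> J\<close>]]
  show "(\<lambda>h. F t (h t)) \<in> borel_measurable (\<Pi>\<^sub>M i\<in>I. state_space)" .
qed

lemma joint_C:
  assumes "\<And>t. F t \<in> borel_measurable state_space"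
  shows "joint n F = (\<integral>\<^sup>+h. (\<Prod>t\<le>n. F t (h t)) \<partial>IT.C 0 (Suc n) start)"
proof -
  let ?J = "{0..<Suc n}"
  have f: "(\<lambda>h. \<Prod>t\<le>n. F t (h t)) \<in> borel_measurable (\<Pi>\<^sub>M i\<in>?J. state_space)"
    by (rule measurable_prod_coordinates) (use assms in auto)
  have res: "(\<lambda>h. restrict h ?J) \<in> IT.PF.lim \<rightarrow>\<^sub>M (\<Pi>\<^sub>M i\<in>?J. state_space)"
    using measurable_restrict_subset[of ?J UNIV "\<lambda>_. state_space"]
    by (simp add: measurable_cong_sets[OF IT.PF.sets_lim refl])
  have "(\<integral>\<^sup>+h. (\<Prod>t\<le>n. F t (h t)) \<partial>IT.C 0 (Suc n) start) =
      (\<integral>\<^sup>+h. (\<Prod>t\<le>n. F t (h t)) \<partial>distr IT.PF.lim (\<Pi>\<^sub>M i\<in>?J. state_space) (\<lambda>h. restrict h ?J))"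
    unfolding CI_initial[symmetric] using IT.distr_lim[of ?J] by simp
  also have "\<dots> = (\<integral>\<^sup>+h. (\<Prod>t\<le>n. F t (restrict h ?J t)) \<partial>IT.PF.lim)"
    by (rule nn_integral_distr[OF res]) (simp add: f)
  also have "\<dots> = joint n F"
    unfolding joint_def walk_measure_eq by (intro nn_integral_cong prod.cong) auto
  finally show ?thesis ..
qed

lemma joint_0:
  assumes F: "\<And>t. F t \<in> borel_measurable state_space"
  shows "joint 0 F = at_root (F 0)"
proof -
  have u: "start \<in> space (\<Pi>\<^sub>M i\<in>{0..<0}. state_space)" by (simp add: space_PiM)
  have f: "(\<lambda>h. F 0 (h 0)) \<in> borel_measurable (\<Pi>\<^sub>M i\<in>{0..<Suc 0}. state_space)"
    using measurable_prod_coordinates[of "{0}" F "{0..<Suc 0}"] F by simp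
  have "IT.C 0 (Suc 0) start = IT.eP 0 start"
    using bind_return[OF IT.measurable_eP u] by (simp only: IT.C.simps add_0_left)
  then have "joint 0 F = (\<integral>\<^sup>+h. F 0 (h 0) \<partial>IT.eP 0 start)"
    unfolding joint_C[of F, OF F] by simp
  also have "\<dots> = (\<integral>\<^sup>+s. F 0 s \<partial>walk_kernel p m 0 start)"
    using IT.nn_integral_eP[OF u f] by simp
  also have "\<dots> = at_root (F 0)"
    unfolding walk_kernel.simps at_root_def
    by (subst nn_integral_distr[OF measurable_start]) (simp_all add: F rt_root_tree_of)
  finally show ?thesis .
qed

text \<open>The Markov property at the last step: given the history, integrating out time
  \<open>Suc n\<close> leaves a function of the state at time \<open>n\<close>, which is absorbed
  into the factor of that time.\<close>

lemma joint_Suc: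
  assumes F: "\<And>t. F t \<in> borel_measurable state_space"
  shows "joint (Suc n) F = joint n (F(n := \<lambda>s. F n s * walk_op m (F (Suc n)) s))"
proof -
  let ?J = "{0..<Suc n}" and ?G = "F(n := \<lambda>s. F n s * walk_op m (F (Suc n)) s)"
  have u: "start \<in> space (\<Pi>\<^sub>M i\<in>{0..<0}. state_space)" by (simp add: space_PiM)
  have G: "?G t \<in> borel_measurable state_space" for t
    using F measurable_walk_op[OF m_pos F] by simp
  have f: "(\<lambda>h. \<Prod>t\<le>Suc n. F t (h t)) \<in> borel_measurable (\<Pi>\<^sub>M i\<in>{0..<Suc (Suc n)}. state_space)"
    by (rule measurable_prod_coordinates) (use F in auto)
  have C: "IT.C 0 (Suc (Suc n)) start = IT.C 0 (Suc n) start \<bind> IT.eP (Suc n)"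
    by (subst IT.C.simps(2)) simp
  have setsC: "sets (IT.C 0 (Suc n) start) = sets (\<Pi>\<^sub>M i\<in>?J. state_space)"
    using IT.sets_C[OF u, of "Suc n"] by simp
  have "joint (Suc n) F = (\<integral>\<^sup>+h. \<integral>\<^sup>+h'. (\<Prod>t\<le>Suc n. F t (h' t)) \<partial>IT.eP (Suc n) h \<partial>IT.C 0 (Suc n) start)"
    unfolding joint_C[of F, OF F] C
  proof (rule nn_integral_bind[OF f])
    show "IT.eP (Suc n) \<in> IT.C 0 (Suc n) start \<rightarrow>\<^sub>M subprob_algebra (\<Pi>\<^sub>M i\<in>{0..<Suc (Suc n)}. state_space)"
      unfolding measurable_cong_sets[OF setsC refl] by (rule IT.measurable_eP)
  qed
  also have "\<dots> = (\<integral>\<^sup>+h. (\<Prod>t\<le>n. ?G t (h t)) \<partial>IT.C 0 (Suc n) start)"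
  proof (rule nn_integral_cong)
    fix h assume "h \<in> space (IT.C 0 (Suc n) start)"
    then have h: "h \<in> space (\<Pi>\<^sub>M i\<in>?J. state_space)" using sets_eq_imp_space_eq[OF setsC] by simp
    have "(\<integral>\<^sup>+h'. (\<Prod>t\<le>Suc n. F t (h' t)) \<partial>IT.eP (Suc n) h) =
        (\<integral>\<^sup>+s. (\<Prod>t\<le>Suc n. F t ((h(Suc n := s)) t)) \<partial>walk_kernel p m (Suc n) h)"
      by (rule IT.nn_integral_eP[OF h f])
    also have "\<dots> = (\<integral>\<^sup>+s. (\<Prod>t\<le>n. F t (h t)) * F (Suc n) s \<partial>step_kernel m (h n))"
      unfolding walk_kernel_Suc by (intro nn_integral_cong) (simp add: mult.commute)
    also have "\<dots> = (\<Prod>t\<le>n. F t (h t)) * walk_op m (F (Suc n)) (h n)"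
      by (subst nn_integral_cmult)
         (simp_all add: F nn_integral_step_kernel measurable_cong_sets[OF sets_step_kernel refl])
    also have "\<dots> = (\<Prod>t\<in>{..n} - {n}. F t (h t)) * (F n (h n) * walk_op m (F (Suc n)) (h n))"
      by (subst prod.remove[of "{..n}" n]) (simp_all add: ac_simps)
    also have "\<dots> = (\<Prod>t\<in>{..n} - {n}. ?G t (h t)) * ?G n (h n)"
      by (intro arg_cong2[where f = "(*)"] prod.cong refl) auto
    also have "\<dots> = (\<Prod>t\<le>n. ?G t (h t))"
      by (rule trans[OF mult.commute prod.remove[symmetric]]) simp_all
    finally show "(\<integral>\<^sup>+h'. (\<Prod>t\<le>Suc n. F t (h' t)) \<partial>IT.eP (Suc n) h) = (\<Prod>t\<le>n. ?G t (h t))" .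
  qed
  also have "\<dots> = joint n ?G" by (rule joint_C[symmetric]) (rule G)
  finally show ?thesis .
qed

section \<open>Reversal of time\<close>

text \<open>The Markov property evaluates \<open>joint n F\<close> as a nested expression that ends with \<open>F 0\<close>, and
  self-adjointness as one that ends with \<open>F n\<close>; comparing the two reverses time.\<close>

primrec nested :: "(nat \<Rightarrow> (label \<Rightarrow> nat) \<times> label \<Rightarrow> ennreal) \<Rightarrow> nat \<Rightarrow> (label \<Rightarrow> nat) \<times> label \<Rightarrow> ennreal" where
  "nested F 0 = F 0"
| "nested F (Suc k) = (\<lambda>s. F (Suc k) s * walk_op m (nested F k) s)"

lemma nested_cong: "(\<And>t. t \<le> n \<Longrightarrow> F t = G t) \<Longrightarrow> nested F n = nested G n"
  by (induction n) auto

text \<open>Merging the two innermost factors matches the way \<open>joint_Suc\<close> absorbs the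
  last time, once the order of times is reversed.\<close>

lemma nested_merge:
  "nested F (Suc n) = nested (\<lambda>t. if t = 0 then (\<lambda>s. F 1 s * walk_op m (F 0) s) else F (Suc t)) n"
  by (induction n) auto

lemma measurable_nested:
  assumes "\<And>t. F t \<in> borel_measurable state_space"
  shows "nested F n \<in> borel_measurable state_space"
  by (induction n) (auto intro!: assms measurable_walk_op[OF m_pos] borel_measurable_times_ennreal)

lemma view_invariant_nested:
  assumes "\<And>t. view_invariant (F t)"
  shows "view_invariant (nested F n)"
  by (induction n) (auto intro!: assms view_invariant_times view_invariant_walk_op[OF m_pos])

lemma joint_nested_reversed:
  assumes "\<And>t. F t \<in> borel_measurable state_space"
  shows "joint n F = at_root (nested (\<lambda>t. F (n - t)) n)"
  using assms
proof (induction n arbitrary: F)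
  case 0 then show ?case by (simp add: joint_0)
next
  case (Suc n)
  let ?G = "F(n := \<lambda>s. F n s * walk_op m (F (Suc n)) s)"
  have "?G t \<in> borel_measurable state_space" for t
    using Suc.prems measurable_walk_op[OF m_pos Suc.prems] by simp
  then have "joint (Suc n) F = at_root (nested (\<lambda>t. ?G (n - t)) n)"
    unfolding joint_Suc[of F, OF Suc.prems] by (rule Suc.IH)
  also have "nested (\<lambda>t. ?G (n - t)) n = nested (\<lambda>t. F (Suc n - t)) (Suc n)"
    unfolding nested_merge by (rule nested_cong) auto
  finally show ?case .
qed

lemma joint_nested:
  assumes "\<And>t. F t \<in> borel_measurable state_space" "\<And>t. view_invariant (F t)"
  shows "joint n F = at_root (nested F n)"
  using assms
proof (induction n arbitrary: F)
  case 0 then show ?case by (simp add: joint_0)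
next
  case (Suc n)
  let ?g = "walk_op m (F (Suc n))"
  let ?G = "F(n := \<lambda>s. F n s * ?g s)"
  have "?G t \<in> borel_measurable state_space" "view_invariant (?G t)" for t
    using Suc.prems measurable_walk_op[OF m_pos, of "F (Suc n)"] view_invariant_walk_op[OF m_pos, of "F (Suc n)"]
    by (auto intro: view_invariant_times)
  then have "joint (Suc n) F = at_root (nested ?G n)"
    unfolding joint_Suc[of F, OF Suc.prems(1)] by (rule Suc.IH)
  \<comment> \<open>\<open>?g\<close> sits in the outermost factor only, so it comes out as a plain
    product and no operator acts on it.\<close>
  also have "nested ?G n = (\<lambda>s. nested F n s * ?g s)"
  proof (cases n)
    case (Suc k)
    have "nested ?G k = nested F k" by (rule nested_cong) (simp add: Suc)
    then have "nested ?G (Suc k) s = nested F (Suc k) s * ?g s" for s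
      by (simp add: Suc ac_simps del: fun_upd_apply) (simp add: ac_simps)
    then show ?thesis unfolding Suc by (rule ext)
  qed simp
  \<comment> \<open>Self-adjointness takes the operator off \<open>F (Suc n)\<close> and puts it on
    \<open>nested F n\<close>; here view invariance is essential.\<close>
  also have "at_root \<dots> = at_root (\<lambda>s. F (Suc n) s * walk_op m (nested F n) s)"
    unfolding at_root_def
    by (rule walk_op_self_adjoint[OF mean])
       (auto intro: Suc.prems measurable_nested view_invariant_nested)
  finally show ?case by simp
qed

lemma joint_reverse:
  assumes "\<And>t. F t \<in> borel_measurable state_space" "\<And>t. view_invariant (F t)"
  shows "joint n (\<lambda>t. F (n - t)) = joint n F"
proof -
  have "joint n (\<lambda>t. F (n - t)) = at_root (nested (\<lambda>t. F (n - (n - t))) n)"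
    by (rule joint_nested_reversed) (rule assms)
  also have "nested (\<lambda>t. F (n - (n - t))) n = nested F n" by (rule nested_cong) simp
  finally show ?thesis using joint_nested[of F n] assms by simp
qed

lemma view_invariant_const: "view_invariant (\<lambda>_. c)"
  by (simp add: view_invariant_def)

lemma joint_cong: "(\<And>t. t \<le> n \<Longrightarrow> F t = G t) \<Longrightarrow> joint n F = joint n G"
  unfolding joint_def by (intro nn_integral_cong prod.cong) auto

lemma joint_shift:
  assumes "\<And>t. F t \<in> borel_measurable state_space" "\<And>t. view_invariant (F t)"
  shows "joint (n + s) (\<lambda>t. if t < s then (\<lambda>_. 1) else F (t - s)) = joint n F"
proof (induction s)
  case (Suc s)
  let ?G = "\<lambda>t. if t < s then (\<lambda>_. 1) else F (t - s)"
  let ?H = "\<lambda>t. if t < Suc s then (\<lambda>_. 1) else F (t - Suc s)"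
  let ?N = "n + s"
  have G: "?G t \<in> borel_measurable state_space" "view_invariant (?G t)"
    and H: "?H t \<in> borel_measurable state_space" "view_invariant (?H t)" for t
    using assms view_invariant_const by auto
  have "joint (Suc ?N) ?H = joint (Suc ?N) (\<lambda>t. ?H (Suc ?N - t))"
    by (rule joint_reverse[symmetric]) (rule H)+
  \<comment> \<open>Reversal has moved the constant factor of time 0 to the last time, where it
    drops out of the product. Reversing the shorter path then leaves every other factor one time
    earlier.\<close>
  also have "\<dots> = joint ?N (\<lambda>t. ?H (Suc ?N - t))"
    by (simp add: joint_def)
  also have "\<dots> = joint ?N (\<lambda>t. ?G (?N - t))"
    by (rule joint_cong) auto
  also have "\<dots> = joint ?N ?G"
    by (rule joint_reverse) (rule G)+
  finally show ?case using Suc.IH by simp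
qed simp

section \<open>Finite-dimensional laws of the environment process\<close>

lemma prob_space_walk_measure: "prob_space (walk_measure p m)"
proof
  have "emeasure (walk_measure p m) (space (walk_measure p m)) = joint 0 (\<lambda>_ _. 1)"
    by (simp add: joint_def)
  also have "\<dots> = at_root (\<lambda>_. 1)" by (rule joint_0) simp
  also have "\<dots> = 1"
    using prob_space.emeasure_space_1[OF prob_space_offspring_numbers] by (simp add: at_root_def)
  finally show "emeasure (walk_measure p m) (space (walk_measure p m)) = 1" .
qed

lemma measurable_environment: "environment t \<in> walk_measure p m \<rightarrow>\<^sub>M tree_space"
proof -
  have "(\<lambda>h. h t) \<in> (\<Pi>\<^sub>M i\<in>UNIV. state_space) \<rightarrow>\<^sub>M state_space"
    by (rule measurable_component_singleton) simp
  from measurable_compose[OF this measurable_view] show ?thesis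
    unfolding measurable_walk_measure by (simp add: environment_view[abs_def])
qed

lemma stochastic_process_environment: "stochastic_process (walk_measure p m) tree_space environment"
  unfolding stochastic_process_def using prob_space_walk_measure measurable_environment by blast

lemma measurable_environments:
  "(\<lambda>h. \<lambda>t\<in>I. environment (f t) h) \<in> walk_measure p m \<rightarrow>\<^sub>M (\<Pi>\<^sub>M t\<in>I. tree_space)"
  by (rule measurable_restrict) (rule measurable_environment)

lemma emeasure_environments:
  assumes "finite J" "J \<subseteq> I" and A: "\<And>t. t \<in> J \<Longrightarrow> A t \<in> sets tree_space"
  shows "emeasure (distr (walk_measure p m) (\<Pi>\<^sub>M t\<in>I. tree_space) (\<lambda>h. \<lambda>t\<in>I. environment (f t) h))
      (prod_emb I (\<lambda>_. tree_space) J (Pi\<^sub>E J A)) =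
    (\<integral>\<^sup>+h. (\<Prod>t\<in>J. indicator (A t) (view (h (f t)))) \<partial>walk_measure p m)"
proof -
  let ?M = "walk_measure p m" and ?X = "prod_emb I (\<lambda>_. tree_space) J (Pi\<^sub>E J A)"
  let ?Y = "\<lambda>h. \<lambda>t\<in>I. environment (f t) h"
  have X: "?X \<in> sets (\<Pi>\<^sub>M t\<in>I. tree_space)" using assms by (intro sets_PiM_I) auto
  have mem: "?Y h \<in> ?X \<longleftrightarrow> (\<forall>t\<in>J. view (h (f t)) \<in> A t)" if "h \<in> space ?M" for h
  proof -
    have "?Y h \<in> space (\<Pi>\<^sub>M t\<in>I. tree_space)" using measurable_space[OF measurable_environments that] .
    then have "?Y h \<in> ?X \<longleftrightarrow> restrict (?Y h) J \<in> Pi\<^sub>E J A" by (simp add: prod_emb_def space_PiM PiE_iff)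
    also have "\<dots> \<longleftrightarrow> (\<forall>t\<in>J. view (h (f t)) \<in> A t)"
      using assms(2) by (auto simp: PiE_iff environment_view subset_iff)
    finally show ?thesis .
  qed
  have "emeasure (distr ?M (\<Pi>\<^sub>M t\<in>I. tree_space) ?Y) ?X =
      (\<integral>\<^sup>+h. indicator ?X (?Y h) \<partial>?M)"
    by (rule emeasure_distr_nn_integral[OF measurable_environments X])
  also have "\<dots> = (\<integral>\<^sup>+h. (\<Prod>t\<in>J. indicator (A t) (view (h (f t)))) \<partial>?M)"
  proof (rule nn_integral_cong)
    fix h assume "h \<in> space ?M"
    from mem[OF this] show "indicator ?X (?Y h) = (\<Prod>t\<in>J. indicator (A t) (view (h (f t))) :: ennreal)"
      using assms(1) by (auto simp: indicator_def intro!: prod.neutral[symmetric] simp del: restrict_apply)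
  qed
  finally show ?thesis .
qed

lemma finite_distr_environments:
  "finite_measure (distr (walk_measure p m) (\<Pi>\<^sub>M t\<in>I. tree_space) (\<lambda>h. \<lambda>t\<in>I. environment (f t) h))"
  using prob_space.prob_space_distr[OF prob_space_walk_measure measurable_environments]
  by (rule prob_space.finite_measure)

text \<open>Unconstrained times get the factor 1, so a box over any finite set of times becomes a
  product over a full initial segment, as \<open>joint\<close> requires.\<close>

definition box :: "nat set \<Rightarrow> (nat \<Rightarrow> label rtree set set) \<Rightarrow> nat \<Rightarrow> (label \<Rightarrow> nat) \<times> label \<Rightarrow> ennreal" where
  "box J A t = (if t \<in> J then (\<lambda>s. indicator (A t) (view s)) else (\<lambda>_. 1))"

lemma box_facts:
  assumes "\<And>t. t \<in> J \<Longrightarrow> A t \<in> sets tree_space"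
  shows "box J A t \<in> borel_measurable state_space" "view_invariant (box J A t)"
proof -
  show "box J A t \<in> borel_measurable state_space"
    using assms measurable_compose[OF measurable_view borel_measurable_indicator[of "A t" tree_space]]
    by (simp add: box_def)
  show "view_invariant (box J A t)"
    using view_invariant_view by (auto simp: box_def view_invariant_def)
qed

lemma prod_box:
  assumes "finite I" "J \<subseteq> I"
  shows "(\<Prod>t\<in>J. indicator (A t) (view (h (f t)))) = (\<Prod>t\<in>I. box J A t (h (f t)))"
  by (rule prod.mono_neutral_cong_left) (use assms in \<open>auto simp: box_def\<close>)

lemma environment_0: "distr (walk_measure p m) tree_space (environment 0) = IGWR p"
proof (rule measure_eqI)
  fix A assume "A \<in> sets (distr (walk_measure p m) tree_space (environment 0))"
  then have A: "A \<in> sets tree_space" by simp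
  have meas: "(\<lambda>\<omega>. iso_class (tree_of \<omega>)) \<in> offspring_numbers p \<rightarrow>\<^sub>M tree_space"
    using measurable_state_spaceD[OF measurable_view, of "(0, [])"]
    by (simp add: view_root measurable_offspring_numbers)
  have F: "(\<lambda>s. indicator A (view s) :: ennreal) \<in> borel_measurable state_space"
    using measurable_compose[OF measurable_view borel_measurable_indicator[OF A]] .
  have "emeasure (distr (walk_measure p m) tree_space (environment 0)) A =
      (\<integral>\<^sup>+h. indicator A (view (h 0)) \<partial>walk_measure p m)"
    unfolding environment_view[symmetric]
    by (rule emeasure_distr_nn_integral[OF measurable_environment A])
  also have "\<dots> = joint 0 (\<lambda>_ s. indicator A (view s))" by (simp add: joint_def)
  also have "\<dots> = at_root (\<lambda>s. indicator A (view s))" by (rule joint_0) (rule F)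
  also have "\<dots> = (\<integral>\<^sup>+\<omega>. indicator A (iso_class (tree_of \<omega>)) \<partial>offspring_numbers p)"
    by (simp add: at_root_def view_root)
  also have "\<dots> = emeasure (IGWR p) A"
    unfolding IGWR_def by (rule emeasure_distr_nn_integral[OF meas A, symmetric])
  finally show "emeasure (distr (walk_measure p m) tree_space (environment 0)) A = emeasure (IGWR p) A" .
qed (simp add: IGWR_def)

lemma reversible_environment: "reversible (walk_measure p m) tree_space environment"
  unfolding reversible_def
proof (intro conjI allI)
  fix n :: nat
  let ?D = "\<lambda>f. distr (walk_measure p m) (\<Pi>\<^sub>M t\<in>{..n}. tree_space) (\<lambda>h. \<lambda>t\<in>{..n}. environment (f t) h)"
  show "?D (\<lambda>t. n - t) = ?D (\<lambda>t. t)"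
  proof (rule measure_eqI_PiM_infinite)
    fix A :: "nat \<Rightarrow> label rtree set set" and J
    assume J: "finite J" "J \<subseteq> {..n}" and A: "\<And>t. t \<in> J \<Longrightarrow> A t \<in> sets tree_space"
    have "(\<Prod>t\<le>n. box J A t (h (n - t))) = (\<Prod>t\<le>n. box J A (n - t) (h t))" for h
      by (rule prod.reindex_bij_witness[of _ "\<lambda>t. n - t" "\<lambda>t. n - t"]) auto
    then have joint: "(\<integral>\<^sup>+h. (\<Prod>t\<in>J. indicator (A t) (view (h (n - t)))) \<partial>walk_measure p m) =
        joint n (\<lambda>t. box J A (n - t))"
      unfolding prod_box[OF finite_atMost J(2), of A _ "\<lambda>t. n - t"] joint_def by simp
    have "emeasure (?D (\<lambda>t. n - t)) (prod_emb {..n} (\<lambda>_. tree_space) J (Pi\<^sub>E J A)) =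
        joint n (\<lambda>t. box J A (n - t))"
      unfolding joint[symmetric] by (rule emeasure_environments[OF J A])
    also have "\<dots> = joint n (box J A)"
      by (rule joint_reverse) (use box_facts[OF A] in auto)
    also have "\<dots> = emeasure (?D (\<lambda>t. t)) (prod_emb {..n} (\<lambda>_. tree_space) J (Pi\<^sub>E J A))"
      unfolding joint_def prod_box[OF finite_atMost J(2), of A _ "\<lambda>t. t", symmetric]
      by (rule emeasure_environments[OF J A, symmetric])
    finally show "emeasure (?D (\<lambda>t. n - t)) (prod_emb {..n} (\<lambda>_. tree_space) J (Pi\<^sub>E J A)) =
      emeasure (?D (\<lambda>t. t)) (prod_emb {..n} (\<lambda>_. tree_space) J (Pi\<^sub>E J A))" .
  qed (simp_all add: finite_distr_environments)
qed (rule stochastic_process_environment)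

lemma stationary_environment: "stationary (walk_measure p m) tree_space environment"
  unfolding stationary_def
proof (intro conjI allI)
  fix s
  \<comment> \<open>Restriction to \<open>UNIV\<close> changes nothing; it gives the process the
    form of \<open>emeasure_environments\<close> and is removed at the end.\<close>
  let ?D = "\<lambda>f. distr (walk_measure p m) (\<Pi>\<^sub>M t\<in>UNIV. tree_space) (\<lambda>h. \<lambda>t\<in>UNIV. environment (f t) h)"
  have "?D (\<lambda>t. s + t) = ?D (\<lambda>t. t)"
  proof (rule measure_eqI_PiM_infinite)
    fix A :: "nat \<Rightarrow> label rtree set set" and J :: "nat set"
    assume J: "finite J" "J \<subseteq> UNIV" and A: "\<And>t. t \<in> J \<Longrightarrow> A t \<in> sets tree_space"
    from J(1) obtain n where n: "J \<subseteq> {..n}" using finite_nat_iff_bounded_le by blast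
    let ?F = "\<lambda>t. if t < s then (\<lambda>_. 1) else box J A (t - s)"
    have "(\<Prod>t\<le>n. box J A t (h (s + t))) = (\<Prod>t\<le>n + s. ?F t (h t))" for h
    proof -
      have "(\<Prod>t\<le>n. box J A t (h (s + t))) = (\<Prod>t\<in>{s..n + s}. ?F t (h t))"
        by (rule prod.reindex_bij_witness[of _ "\<lambda>t. t - s" "\<lambda>t. s + t"]) auto
      also have "\<dots> = (\<Prod>t\<le>n + s. ?F t (h t))"
        by (rule prod.mono_neutral_left) auto
      finally show ?thesis .
    qed
    then have joint: "(\<integral>\<^sup>+h. (\<Prod>t\<in>J. indicator (A t) (view (h (s + t)))) \<partial>walk_measure p m) = joint (n + s) ?F"
      unfolding prod_box[OF finite_atMost n, of A _ "\<lambda>t. s + t"] joint_def by simp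
    have "emeasure (?D (\<lambda>t. s + t)) (prod_emb UNIV (\<lambda>_. tree_space) J (Pi\<^sub>E J A)) = joint (n + s) ?F"
      unfolding joint[symmetric] by (rule emeasure_environments[OF J A])
    also have "\<dots> = joint n (box J A)"
      by (rule joint_shift) (use box_facts[OF A] in auto)
    also have "\<dots> = emeasure (?D (\<lambda>t. t)) (prod_emb UNIV (\<lambda>_. tree_space) J (Pi\<^sub>E J A))"
      unfolding joint_def prod_box[OF finite_atMost n, of A _ "\<lambda>t. t", symmetric]
      by (rule emeasure_environments[OF J A, symmetric])
    finally show "emeasure (?D (\<lambda>t. s + t)) (prod_emb UNIV (\<lambda>_. tree_space) J (Pi\<^sub>E J A)) =
      emeasure (?D (\<lambda>t. t)) (prod_emb UNIV (\<lambda>_. tree_space) J (Pi\<^sub>E J A))" .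
  qed (simp_all add: finite_distr_environments)
  then show "distr (walk_measure p m) (\<Pi>\<^sub>M t\<in>UNIV. tree_space) (\<lambda>h t. environment (s + t) h) =
    distr (walk_measure p m) (\<Pi>\<^sub>M t\<in>UNIV. tree_space) (\<lambda>h t. environment t h)"
    by (simp add: restrict_def)
qed (rule stochastic_process_environment)

end

theorem lemma2:
  fixes p :: "nat pmf" and \<beta> :: real
  assumes "pmf p 0 = 0"
    and "mean p > 1"
    and "\<beta> > 1" and "summable (\<lambda>k. \<beta> ^ k * pmf p k)"
  shows "distr (walk_measure p (mean p)) tree_space (environment 0) = IGWR p \<and>
    stationary (walk_measure p (mean p)) tree_space environment \<and>
    reversible (walk_measure p (mean p)) tree_space environment"
proof -
  interpret biased_walk p by (rule biased_walk.intro) (rule assms(2))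
  show ?thesis using environment_0 stationary_environment reversible_environment by blast
qed

end
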